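(* Let $A^{\{1,3\}}_{132}(z)=\sum_{n\ge0}a_n z^n$, where $a_n$ is the number of permutations $\pi\in\mathfrak{S}_n$ that avoid $132$ and all of whose cycles have length $1$ or $3$ (with $a_0=1$). Let $c(x)=\frac{1-\sqrt{1-4x}}{2x}$ be the generating function of the Catalan numbers, let \[m(t,x)=\dfrac{2}{1-2tx+x+\sqrt{1-2x-3x^2}},\] and let $F(t,x)=1+xt\,m(t,x)$. Then \[ A^{\{1,3\}}_{132}(z)=\frac{1}{1-z}\,F\!\left(\frac{2}{1-z},\,c(z^3)-1\right), \] and equivalently \[ A^{\{1,3\}}_{132}(z)=\dfrac{c(z^3)}{\sqrt{c(z^3)\,(4-3c(z^3))}-z\,c(z^3)}. \]
   Context: $\mathfrak{S}_n$ is the symmetric group on $[n]$, with permutations written in one-line notation $\pi_1\cdots\pi_n$. A permutation contains a pattern $\sigma$ if some subsequence of its one-line notation is in the same relative order as $\sigma$; otherwise it avoids $\sigma$. The function $m(t,x)$ is the bivariate generating function $\sum_{k,j}M_{k,j}x^kt^j$ where $M_{k,j}$ is the number of Motzkin paths of length $k$ with exactly $j$ flat steps at height zero. *)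

theory Defs
  imports Complex_Main "HOL-Combinatorics.Permutations"
begin

text \<open>Permutations of [n] are represented (0-indexed) as bijections of {0..<n}
  that fix everything else; the one-line notation is pi 0, ..., pi (n-1).\<close>

definition contains_pattern :: "(nat \<Rightarrow> nat) \<Rightarrow> nat \<Rightarrow> (nat \<Rightarrow> nat) \<Rightarrow> nat \<Rightarrow> bool" where
  "contains_pattern p n s k \<longleftrightarrow>
     (\<exists>f. (\<forall>a b. a < b \<and> b < k \<longrightarrow> f a < f b) \<and> (\<forall>a<k. f a < n) \<and>
          (\<forall>a<k. \<forall>b<k. p (f a) < p (f b) \<longleftrightarrow> s a < s b))"

definition avoids_pattern :: "(nat \<Rightarrow> nat) \<Rightarrow> nat \<Rightarrow> (nat \<Rightarrow> nat) \<Rightarrow> nat \<Rightarrow> bool" where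
  "avoids_pattern p n s k \<longleftrightarrow> \<not> contains_pattern p n s k"

definition pat132 :: "nat \<Rightarrow> nat" where
  "pat132 i = (if i = 0 then 0 else if i = 1 then 2 else if i = 2 then 1 else i)"

definition cycle_len :: "(nat \<Rightarrow> nat) \<Rightarrow> nat \<Rightarrow> nat" where
  "cycle_len p i = (LEAST k. 0 < k \<and> (p ^^ k) i = i)"

definition A13_132 :: "nat \<Rightarrow> nat" where
  "A13_132 n = card {p. p permutes {0..<n} \<and> avoids_pattern p n pat132 3 \<and>
                        (\<forall>i<n. cycle_len p i \<in> {1, 3})}"

text \<open>Catalan generating function, with its value 1 at x = 0 (removable singularity).\<close>
definition catalan_gf :: "real \<Rightarrow> real" where
  "catalan_gf x = (if x = 0 then 1 else (1 - sqrt (1 - 4 * x)) / (2 * x))"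

definition motzkin_m :: "real \<Rightarrow> real \<Rightarrow> real" where
  "motzkin_m t x = 2 / (1 - 2 * t * x + x + sqrt (1 - 2 * x - 3 * x ^ 2))"

definition F_tx :: "real \<Rightarrow> real \<Rightarrow> real" where
  "F_tx t x = 1 + x * t * motzkin_m t x"

end

theory Submission
  imports Defs "HOL-Complex_Analysis.Complex_Analysis"
begin

text \<open>
  The permutations counted are the 132-avoiders \<open>\<pi>\<close> with \<open>\<pi>\<^sup>3 = id\<close>. If the last point is not fixed,
  its cycle is \<open>j - 1 \<rightarrow> n - 1 \<rightarrow> k \<rightarrow> j - 1\<close>, and inversion exchanges the cases \<open>j - 1 < k\<close> and
  \<open>k < j - 1\<close>. If \<open>j - 1 < k\<close>, avoidance of 132 forces three blocks of \<open>j\<close> consecutive points,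
  the first, the last and one ending at \<open>k\<close>, which \<open>\<pi>\<close> permutes cyclically; the pattern \<open>\<tau>\<close> on
  the first block is any 132-avoider with its maximum at the end, and removing the blocks leaves a smaller
  permutation \<open>\<rho>\<close> of the same kind. Conversely the middle block can be inserted into \<open>\<rho>\<close> at
  certain \<^emph>\<open>sites\<close>, and if \<open>\<rho>\<close> has \<open>r\<close> sites, the results have \<open>2, \<dots>, r + 1\<close> sites:
  the Catalan generating tree, with weight \<open>q = z\<^sup>3 c(z\<^sup>3)\<close> per step. Solving it by the kernel method
  with \<open>g = q + g\<^sup>2\<close> gives \<open>A = 1 + z A + 2 g A\<close>, that is
  \<open>A = 1 / (sqrt (2 * sqrt (1 - 4 z\<^sup>3) - 1) - z)\<close>.
\<close>

section \<open>132-avoiding permutations and the Catalan recurrence\<close>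

definition avoids132 :: "nat \<Rightarrow> (nat \<Rightarrow> nat) \<Rightarrow> bool" where
  "avoids132 n p \<longleftrightarrow> (\<forall>a b c. a < b \<and> b < c \<and> c < n \<longrightarrow> \<not> (p a < p c \<and> p c < p b))"

definition Av :: "nat \<Rightarrow> (nat \<Rightarrow> nat) set" where
  "Av n = {p. p permutes {..<n} \<and> avoids132 n p}"

text \<open>A permutation has all cycle lengths in {1, 3} exactly when its cube is the identity, and
  the equation can be checked block by block.\<close>

definition Cub :: "nat \<Rightarrow> (nat \<Rightarrow> nat) set" where
  "Cub n = {p \<in> Av n. \<forall>i. p (p (p i)) = i}"

lemma avoids132D:
  "avoids132 n p \<Longrightarrow> a < b \<Longrightarrow> b < c \<Longrightarrow> c < n \<Longrightarrow> p a < p c \<Longrightarrow> p c < p b \<Longrightarrow> False"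
  unfolding avoids132_def by blast

lemma contains_pat132_iff:
  "contains_pattern p n pat132 3 \<longleftrightarrow> (\<exists>a b c. a < b \<and> b < c \<and> c < n \<and> p a < p c \<and> p c < p b)"
proof
  assume "contains_pattern p n pat132 3"
  then obtain f where f: "\<And>a b. a < b \<Longrightarrow> b < 3 \<Longrightarrow> f a < f b" "\<And>a. a < 3 \<Longrightarrow> f a < n"
    "\<And>a b. a < 3 \<Longrightarrow> b < 3 \<Longrightarrow> p (f a) < p (f b) \<longleftrightarrow> pat132 a < pat132 b"
    unfolding contains_pattern_def by blast
  have "f 0 < f 1" "f 1 < f 2" "f 2 < n" "p (f 0) < p (f 2)" "p (f 2) < p (f 1)"
    using f(1)[of 0 1] f(1)[of 1 2] f(2)[of 2] f(3)[of 0 2] f(3)[of 2 1] by (auto simp: pat132_def)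
  then show "\<exists>a b c. a < b \<and> b < c \<and> c < n \<and> p a < p c \<and> p c < p b" by blast
next
  assume "\<exists>a b c. a < b \<and> b < c \<and> c < n \<and> p a < p c \<and> p c < p b"
  then obtain a b c where abc: "a < b" "b < c" "c < n" "p a < p c" "p c < p b" by blast
  define f where "f = (\<lambda>i::nat. if i = 0 then a else if i = 1 then b else c)"
  have "x = 0 \<or> x = 1 \<or> x = 2" if "x < 3" for x :: nat using that by linarith
  then show "contains_pattern p n pat132 3"
    unfolding contains_pattern_def using abc
    by (intro exI[of _ f]) (fastforce simp: f_def pat132_def)
qed

lemma cycle_len_13_iff:
  assumes p: "p permutes {..<n}"
  shows "(\<forall>i<n. cycle_len p i \<in> {1, 3}) \<longleftrightarrow> (\<forall>i. p (p (p i)) = i)"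
proof
  assume L: "\<forall>i<n. cycle_len p i \<in> {1, 3}"
  show "\<forall>i. p (p (p i)) = i"
  proof
    fix i
    show "p (p (p i)) = i"
    proof (cases "i < n")
      case False
      then show ?thesis using p by (simp add: permutes_not_in)
    next
      case True
      \<comment> \<open>\<open>cycle_len\<close> is a \<open>LEAST\<close>, so some positive period
        must be exhibited first; finiteness provides one.\<close>
      have "\<exists>k>0. (p ^^ k) i = i"
        using permutes_imp_permutation[OF _ p] permutation_self[of p i] by auto
      then have "(p ^^ cycle_len p i) i = i"
        unfolding cycle_len_def by (rule LeastI2_ex) auto
      then show ?thesis using L True by (auto simp: numeral_3_eq_3)
    qed
  qed
next
  assume R: "\<forall>i. p (p (p i)) = i"
  show "\<forall>i<n. cycle_len p i \<in> {1, 3}"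
  proof (intro allI impI)
    fix i assume "i < n"
    show "cycle_len p i \<in> {1, 3}"
    proof (cases "p i = i")
      case True
      then have "cycle_len p i = 1"
        unfolding cycle_len_def by (intro Least_equality) auto
      then show ?thesis by simp
    next
      case False
      have "cycle_len p i = 3"
        unfolding cycle_len_def
      proof (intro Least_equality)
        fix k assume k: "0 < k \<and> (p ^^ k) i = i"
        have "k \<noteq> 1" using k False by auto
        \<comment> \<open>Period 2 together with period 3 would make \<open>i\<close> a fixed
          point.\<close>
        moreover have "k \<noteq> 2" using k False R by (metis funpow_0 comp_apply funpow.simps(2) numeral_2_eq_2)
        ultimately show "3 \<le> k" using k by linarith
      qed (use R in \<open>auto simp: numeral_3_eq_3\<close>)
      then show ?thesis by simp
    qed
  qed
qed

lemma A13_132_eq: "A13_132 n = card (Cub n)"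
proof -
  have "{p. p permutes {0..<n} \<and> avoids_pattern p n pat132 3 \<and> (\<forall>i<n. cycle_len p i \<in> {1, 3})} = Cub n"
    using cycle_len_13_iff[of _ n]
    by (auto simp: Cub_def Av_def avoids_pattern_def contains_pat132_iff avoids132_def atLeast0LessThan)
  then show ?thesis by (simp add: A13_132_def)
qed

section \<open>Inverses of 132-avoiders and the position of the maximum\<close>

lemma finite_Av [simp]: "finite (Av n)"
  by (rule finite_subset[OF _ finite_permutations[of "{..<n}"]]) (auto simp: Av_def)

lemma finite_Cub [simp]: "finite (Cub n)"
  by (rule finite_subset[OF _ finite_Av[of n]]) (auto simp: Cub_def)

lemma permutes_lessThanI:
  fixes p :: "nat \<Rightarrow> nat"
  assumes "inj_on p {..<n}" "\<And>x. x < n \<Longrightarrow> p x < n" "\<And>x. n \<le> x \<Longrightarrow> p x = x"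
  shows "p permutes {..<n}"
proof (rule bij_imp_permutes)
  show "bij_betw p {..<n} {..<n}"
    unfolding bij_betw_def using assms(1,2) endo_inj_surj[of "{..<n}" p] by auto
qed (use assms(3) in auto)

lemma permutes_lessThan_iff:
  fixes p :: "nat \<Rightarrow> nat"
  assumes "p permutes {..<n}" shows "p x < n \<longleftrightarrow> x < n"
  using permutes_in_image[OF assms] by auto

lemma permutes_eqI:
  fixes p q :: "nat \<Rightarrow> nat"
  assumes "p permutes {..<n}" "q permutes {..<n}" "\<And>x. x < n \<Longrightarrow> p x = q x"
  shows "p = q"
proof
  fix x show "p x = q x"
    using assms by (cases "x < n") (auto simp: permutes_not_in)
qed

text \<open>The pattern 132 is its own inverse: positions \<open>a < b < c\<close> of an occurrence
  in \<open>inv p\<close> are values of an occurrence in \<open>p\<close> at positions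
  \<open>inv p a < inv p c < inv p b\<close>.\<close>

lemma Av_inv:
  assumes "p \<in> Av n" shows "inv p \<in> Av n"
proof -
  have p: "p permutes {..<n}" and av: "avoids132 n p" using assms by (auto simp: Av_def)
  have ip: "inv p permutes {..<n}" using p by (rule permutes_inv)
  have False if h: "a < b" "b < c" "c < n" "inv p a < inv p c" "inv p c < inv p b" for a b c
  proof -
    have "inv p b < n" using h permutes_lessThan_iff[OF ip] by auto
    moreover have "p (inv p x) = x" for x using p by (simp add: permutes_inverses)
    ultimately show False using avoids132D[OF av h(4,5)] h by auto
  qed
  then show ?thesis using ip by (auto simp: Av_def avoids132_def)
qed

text \<open>By counting: each of the first \<open>j\<close> values lies above \<open>n - j\<close>
  others, and each later value lies below \<open>j\<close> others.\<close>

lemma permutes_top_segment: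
  fixes p :: "nat \<Rightarrow> nat"
  assumes p: "p permutes {..<n}" and "j \<le> n"
    and gt: "\<And>a b. a < j \<Longrightarrow> j \<le> b \<Longrightarrow> b < n \<Longrightarrow> p b < p a" and "a < n"
  shows "a < j \<longleftrightarrow> n \<le> p a + j"
proof -
  have inj: "inj p" using p by (rule permutes_inj)
  have "p a + j \<ge> n" if "a < j"
  proof -
    have "p ` {j..<n} \<subseteq> {..<p a}" using gt that by auto
    then have "card (p ` {j..<n}) \<le> p a" using card_mono[of "{..<p a}"] by fastforce
    then show ?thesis using inj by (simp add: card_image inj_on_subset)
  qed
  moreover have "p a + j < n" if "j \<le> a"
  proof -
    have "p ` {..<j} \<subseteq> {p a<..<n}" using gt that assms(2,4) permutes_lessThan_iff[OF p] by auto
    then have "card (p ` {..<j}) \<le> n - Suc (p a)" using card_mono[of "{p a<..<n}"] by fastforce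
    then have "j \<le> n - Suc (p a)" using inj by (simp add: card_image inj_on_subset)
    moreover have "p a < n" using permutes_lessThan_iff[OF p] assms(4) by auto
    ultimately show ?thesis by linarith
  qed
  ultimately show ?thesis by (meson not_le)
qed

text \<open>Allows a bijection to be given as a relation, so that neither direction has to be
  written as a function.\<close>

lemma card_eq_via_relation:
  assumes "\<And>x. x \<in> X \<Longrightarrow> \<exists>y\<in>Y. R x y" "\<And>y. y \<in> Y \<Longrightarrow> \<exists>x\<in>X. R x y"
    and "\<And>x y y'. x \<in> X \<Longrightarrow> y \<in> Y \<Longrightarrow> y' \<in> Y \<Longrightarrow> R x y \<Longrightarrow> R x y' \<Longrightarrow> y = y'"
    and "\<And>x x' y. x \<in> X \<Longrightarrow> x' \<in> X \<Longrightarrow> y \<in> Y \<Longrightarrow> R x y \<Longrightarrow> R x' y \<Longrightarrow> x = x'"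
  shows "card X = card Y"
proof -
  obtain f where f: "\<And>x. x \<in> X \<Longrightarrow> f x \<in> Y \<and> R x (f x)" using assms(1) by metis
  have "inj_on f X" using f assms(4) by (auto intro!: inj_onI) metis
  moreover have "f ` X = Y" using f assms(2,3) by blast
  ultimately show ?thesis by (metis card_image)
qed

text \<open>An entry before the maximum that is smaller than an entry after it would form 132 with
  the maximum, so \<open>permutes_top_segment\<close> applies.\<close>

lemma Av_before_max:
  assumes "p \<in> Av (Suc n)" "p j = n" "j \<le> n" "a < Suc n"
  shows "a \<le> j \<longleftrightarrow> n \<le> p a + j"
proof -
  have p: "p permutes {..<Suc n}" and av: "avoids132 (Suc n) p" using assms by (auto simp: Av_def)
  have inj: "p x = p y \<longleftrightarrow> x = y" for x y using permutes_inj[OF p] by (auto dest: injD)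
  have bd: "p x \<le> n" if "x \<le> n" for x using permutes_lessThan_iff[OF p, of x] that by auto
  have gt: "p b < p a" if "a < Suc j" "Suc j \<le> b" "b < Suc n" for a b
  proof (cases "a = j")
    case True
    then show ?thesis using bd[of b] that assms(2) inj[of b j] by auto
  next
    case False
    have "p b \<noteq> n" "p a \<noteq> p b" using inj[of b j] inj[of a b] assms(2) that by auto
    then show ?thesis using avoids132D[OF av, of a j b] that False bd[of b] assms(2) by fastforce
  qed
  show ?thesis using permutes_top_segment[OF p, of "Suc j" a] gt assms(3,4) by auto
qed

text \<open>By \<open>Av_before_max\<close> the entries before the maximum are a 132-avoider shifted
  up by \<open>n - j\<close>, and those after it are a 132-avoider as they stand; conversely no 132
  can straddle the maximum.\<close>

lemma card_Av_max_at:
  assumes "j \<le> n"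
  shows "card {p \<in> Av (Suc n). p j = n} = card (Av j) * card (Av (n - j))"
proof -
  let ?R = "\<lambda>p (L, R). (\<forall>a<j. p a = n - j + L a) \<and> p j = n \<and> (\<forall>b<n - j. p (Suc j + b) = R b)"
  have "card {p \<in> Av (Suc n). p j = n} = card (Av j \<times> Av (n - j))"
  proof (rule card_eq_via_relation[where R = ?R])
    fix p assume "p \<in> {p \<in> Av (Suc n). p j = n}"
    then have p: "p permutes {..<Suc n}" and av: "avoids132 (Suc n) p" and pj: "p j = n"
      by (auto simp: Av_def)
    have inj: "p x = p y \<longleftrightarrow> x = y" for x y using permutes_inj[OF p] by (auto dest: injD)
    have bd: "p x \<le> n" if "x \<le> n" for x using permutes_lessThan_iff[OF p, of x] that by auto
    have seg: "a \<le> j \<longleftrightarrow> n \<le> p a + j" if "a < Suc n" for a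
      using Av_before_max[of p n j a] p av pj that assms by (auto simp: Av_def)
    define L where "L = (\<lambda>a. if a < j then p a - (n - j) else a)"
    define R where "R = (\<lambda>b. if b < n - j then p (Suc j + b) else b)"
    have pl: "n - j \<le> p a" "p a < n" if "a < j" for a
      using seg[of a] bd[of a] that assms inj[of a j] pj by auto
    have pr: "p (Suc j + b) < n - j" if "b < n - j" for b
      using seg[of "Suc j + b"] that assms by linarith
    have "L permutes {..<j}"
    proof (rule permutes_lessThanI)
      show "inj_on L {..<j}"
      proof (rule inj_onI)
        fix x y assume "x \<in> {..<j}" "y \<in> {..<j}" "L x = L y"
        then show "x = y" using pl[of x] pl[of y] inj[of x y] by (auto simp: L_def)
      qed
      show "L x < j" if "x < j" for x using pl[of x] that by (auto simp: L_def)
    qed (auto simp: L_def)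
    moreover have "avoids132 j L"
      unfolding avoids132_def
    proof (intro allI impI notI)
      fix a b c assume h: "a < b \<and> b < c \<and> c < j" and v: "L a < L c \<and> L c < L b"
      then have "p a - (n - j) < p c - (n - j)" "p c - (n - j) < p b - (n - j)" by (auto simp: L_def)
      then have "p a < p c" "p c < p b" by linarith+
      then show False using avoids132D[OF av, of a b c] h assms by auto
    qed
    moreover have "R permutes {..<n - j}"
    proof (rule permutes_lessThanI)
      show "inj_on R {..<n - j}" using inj by (auto intro!: inj_onI simp: R_def)
      show "R x < n - j" if "x < n - j" for x using pr[of x] that by (auto simp: R_def)
    qed (auto simp: R_def)
    moreover have "avoids132 (n - j) R"
      unfolding avoids132_def
    proof (intro allI impI notI)
      fix a b c assume h: "a < b \<and> b < c \<and> c < n - j" and v: "R a < R c \<and> R c < R b"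
      then show False using avoids132D[OF av, of "Suc j + a" "Suc j + b" "Suc j + c"] assms
        by (auto simp: R_def less_diff_conv)
    qed
    ultimately show "\<exists>y\<in>Av j \<times> Av (n - j). ?R p y"
      using pl pj by (intro bexI[of _ "(L, R)"]) (auto simp: Av_def L_def R_def)
  next
    fix y assume "y \<in> Av j \<times> Av (n - j)"
    then obtain L R where y: "y = (L, R)" and L: "L permutes {..<j}" "avoids132 j L"
      and R: "R permutes {..<n - j}" "avoids132 (n - j) R" by (auto simp: Av_def)
    define p where "p = (\<lambda>a. if a < j then n - j + L a else if a = j then n
        else if a \<le> n then R (a - Suc j) else a)"
    have Lb: "L a < j" if "a < j" for a using permutes_lessThan_iff[OF L(1)] that by auto
    have Rb: "R a < n - j" if "a < n - j" for a using permutes_lessThan_iff[OF R(1)] that by auto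
    have Li: "L x = L y \<longleftrightarrow> x = y" for x y using permutes_inj[OF L(1)] by (auto dest: injD)
    have Ri: "R x = R y \<longleftrightarrow> x = y" for x y using permutes_inj[OF R(1)] by (auto dest: injD)
    have p1: "p a = n - j + L a" "n - j \<le> p a" "p a < n" if "a < j" for a
      using that Lb[of a] assms by (auto simp: p_def)
    have p2: "p j = n" by (simp add: p_def)
    have p3: "p a = R (a - Suc j)" "p a < n - j" if "j < a" "a \<le> n" for a
      using that Rb[of "a - Suc j"] by (auto simp: p_def)
    have cs: "a < j \<or> a = j \<or> j < a" for a by linarith
    have "p permutes {..<Suc n}"
    proof (rule permutes_lessThanI)
      show "inj_on p {..<Suc n}"
      proof (rule linorder_inj_onI')
        fix x y assume h: "x \<in> {..<Suc n}" "y \<in> {..<Suc n}" "x < y"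
        show "p x \<noteq> p y"
          using cs[of x] cs[of y] h p1[of x] p1[of y] p2 p3[of x] p3[of y] Li[of x y]
            Ri[of "x - Suc j" "y - Suc j"] by (elim disjE) auto
      qed
      show "p x < Suc n" if "x < Suc n" for x
        using that cs[of x] p1[of x] p2 p3[of x] by (elim disjE) auto
    qed (use assms in \<open>auto simp: p_def\<close>)
    moreover have "avoids132 (Suc n) p"
      unfolding avoids132_def
    proof (intro allI impI notI)
      fix a b c assume h: "a < b \<and> b < c \<and> c < Suc n" and v: "p a < p c \<and> p c < p b"
      show False
      proof (cases "a < j")
        case True
        then have c: "c < j" using v h p1[of a] p3[of c] p2 cs[of c] p1[of b] p3[of b] cs[of b]
          by auto
        then show ?thesis using avoids132D[OF L(2), of a b c] h v p1[of a] p1[of b] p1[of c] by auto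
      next
        case False
        then have "j < a" using cs[of a] h v p2 p3[of b] p3[of c] by auto
        moreover from this have "c - Suc j < n - j" using h by linarith
        ultimately show ?thesis
          using avoids132D[OF R(2), of "a - Suc j" "b - Suc j" "c - Suc j"] h v p3(1)[of a] p3(1)[of b]
            p3(1)[of c] by (simp add: diff_less_mono)
      qed
    qed
    moreover have "?R p y" using y assms by (auto simp: p_def)
    ultimately show "\<exists>p\<in>{p \<in> Av (Suc n). p j = n}. ?R p y"
      using p2 by (auto simp: Av_def)
  next
    fix p y y' assume "y \<in> Av j \<times> Av (n - j)" "y' \<in> Av j \<times> Av (n - j)" "?R p y" "?R p y'"
    then obtain L R L' R' where y: "y = (L, R)" "y' = (L', R')"
      and h: "L permutes {..<j}" "L' permutes {..<j}" "R permutes {..<n - j}" "R' permutes {..<n - j}"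
      "\<forall>a<j. L a = L' a" "\<forall>b<n - j. R b = R' b" by (fastforce simp: Av_def)
    have "L = L'" using permutes_eqI[OF h(1,2)] h(5) by blast
    moreover have "R = R'" using permutes_eqI[OF h(3,4)] h(6) by blast
    ultimately show "y = y'" using y by simp
  next
    fix p p' y assume h: "p \<in> {p \<in> Av (Suc n). p j = n}" "p' \<in> {p \<in> Av (Suc n). p j = n}"
      "y \<in> Av j \<times> Av (n - j)" "?R p y" "?R p' y"
    show "p = p'"
    proof (rule permutes_eqI[of _ "Suc n"])
      fix x assume "x < Suc n"
      then have "x < j \<or> x = j \<or> (\<exists>b<n - j. x = Suc j + b)"
        using assms by presburger
      then show "p x = p' x" using h by auto
    qed (use h in \<open>auto simp: Av_def\<close>)
  qed
  then show ?thesis by (simp add: card_cartesian_product)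
qed

lemma card_Av_0: "card (Av 0) = 1"
proof -
  have "Av 0 = {id}" by (auto simp: Av_def avoids132_def permutes_empty)
  then show ?thesis by simp
qed

lemma card_Av_Suc: "card (Av (Suc n)) = (\<Sum>j\<le>n. card (Av j) * card (Av (n - j)))"
proof -
  have "\<exists>j\<le>n. p j = n" if "p \<in> Av (Suc n)" for p
  proof -
    have p: "p permutes {..<Suc n}" using that by (auto simp: Av_def)
    then have "p (inv p n) = n" by (simp add: permutes_inverses)
    moreover have "inv p n < Suc n" using permutes_lessThan_iff[OF permutes_inv[OF p]] by auto
    ultimately show ?thesis by (intro exI[of _ "inv p n"]) auto
  qed
  then have eq: "Av (Suc n) = (\<Union>j\<le>n. {p \<in> Av (Suc n). p j = n})" by auto
  have dis: "i = j" if "p \<in> Av (Suc n)" "p i = n" "p j = n" for p i j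
    using permutes_inj[of p "{..<Suc n}"] that by (auto simp: Av_def dest: injD)
  have "card (\<Union>j\<le>n. {p \<in> Av (Suc n). p j = n}) = (\<Sum>j\<le>n. card {p \<in> Av (Suc n). p j = n})"
    by (rule card_UN_disjoint) (use dis in auto)
  then show ?thesis using eq card_Av_max_at by simp
qed

section \<open>Splicing a family of 3-cycles into a permutation\<close>

text \<open>A site \<open>u\<close> is recorded as the number of points above the gap where the middle block may be
  inserted: the first \<open>u\<close> positions carry the top \<open>u\<close> values, and the last \<open>u\<close> positions are increasing
  with values below the gap.\<close>

definition sites :: "nat \<Rightarrow> (nat \<Rightarrow> nat) \<Rightarrow> nat set" where
  "sites n p = {u. u \<le> n \<and> (\<forall>a<n. a < u \<longleftrightarrow> n \<le> p a + u) \<and> (\<forall>a<n. n \<le> a + u \<longrightarrow> p a + u < n) \<and>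
     (\<forall>a b. n \<le> a + u \<and> a < b \<and> b < n \<longrightarrow> p a < p b)}"

text \<open>For \<open>v \<le> m\<close>, the order embedding of the \<open>m\<close> points of
  \<open>\<rho>\<close> that leaves free the bottom block below \<open>j\<close>, the middle block
  from \<open>v + j\<close> to \<open>v + 2 * j - 1\<close>, and everything from
  \<open>m + 2 * j\<close> on.\<close>

definition emb :: "nat \<Rightarrow> nat \<Rightarrow> nat \<Rightarrow> nat" where
  "emb j v x = (if x < v then x + j else x + 2 * j)"

text \<open>\<open>\<pi>\<close> arises from \<open>\<rho>\<close>, a permutation of \<open>m\<close> points, by adding blocks of length \<open>j\<close> at the bottom,
  in the gap below \<open>v\<close>, and at the top, with bottom \<open>\<rightarrow>\<close> top via \<open>\<tau>\<close>, top \<open>\<rightarrow>\<close> middle increasing, and middle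
  \<open>\<rightarrow>\<close> bottom via \<open>inv \<tau>\<close>.\<close>

definition spliced :: "nat \<Rightarrow> nat \<Rightarrow> nat \<Rightarrow> (nat \<Rightarrow> nat) \<Rightarrow> (nat \<Rightarrow> nat) \<Rightarrow> (nat \<Rightarrow> nat) \<Rightarrow> bool" where
  "spliced j v m \<tau> \<rho> \<pi> \<longleftrightarrow>
     (\<forall>y<j. \<pi> y = m + 2 * j + \<tau> y) \<and> (\<forall>y<j. \<pi> (m + 2 * j + y) = v + j + y) \<and>
     (\<forall>y<j. \<pi> (v + j + \<tau> y) = y) \<and> (\<forall>x<m. \<pi> (emb j v x) = emb j v (\<rho> x))"

lemma emb_less_iff: "emb j v x < emb j v y \<longleftrightarrow> x < y"
  by (auto simp: emb_def)

lemma emb_eq_iff: "emb j v x = emb j v y \<longleftrightarrow> x = y"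
  by (auto simp: emb_def)

text \<open>Cases 1 to 4 are the bottom block, the points of \<open>\<rho>\<close>, the middle block
  and the top block.\<close>

lemma splice_position_cases:
  assumes "y < m + 3 * j" "v \<le> m"
  obtains "y < j" | x where "x < m" "y = emb j v x" | x where "x < j" "y = v + j + x"
    | x where "x < j" "y = m + 2 * j + x"
proof -
  consider "y < j" | "j \<le> y" "y < v + j" | "v + j \<le> y" "y < v + 2 * j" | "v + 2 * j \<le> y" "y < m + 2 * j"
    | "m + 2 * j \<le> y" by linarith
  then show ?thesis
  proof cases
    case 2
    then have "y - j < m" "y = emb j v (y - j)" using assms by (auto simp: emb_def)
    then show ?thesis by (rule that(2))
  next
    case 3
    then show ?thesis using that(3)[of "y - (v + j)"] by auto
  next
    case 4
    then have "y - 2 * j < m" "y = emb j v (y - 2 * j)" using assms by (auto simp: emb_def)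
    then show ?thesis by (rule that(2))
  next
    case 5
    then show ?thesis using that(4)[of "y - (m + 2 * j)"] assms by auto
  qed (use that in auto)
qed

lemma Av_pred_permutes:
  assumes "\<tau> \<in> Av (j - 1)" shows "\<tau> permutes {..<j}"
  using assms permutes_subset[of \<tau> "{..<j - 1}" "{..<j}"] by (auto simp: Av_def)

text \<open>A final maximum could only be the third entry of a 132, which is not the
  largest.\<close>

lemma Av_pred_avoids:
  assumes "\<tau> \<in> Av (j - 1)" shows "avoids132 j \<tau>"
  unfolding avoids132_def
proof (intro allI impI notI)
  fix a b c assume h: "a < b \<and> b < c \<and> c < j" "\<tau> a < \<tau> c \<and> \<tau> c < \<tau> b"
  have t: "\<tau> permutes {..<j - 1}" "avoids132 (j - 1) \<tau>" using assms by (auto simp: Av_def)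
  show False
  proof (cases "c < j - 1")
    case True
    then show ?thesis using avoids132D[OF t(2)] h by blast
  next
    case False
    then have "c = j - 1" using h by auto
    then have "\<tau> c = j - 1" "\<tau> b < j - 1"
      using h t permutes_lessThan_iff[OF t(1), of b] by (auto simp: permutes_not_in)
    then show ?thesis using h by auto
  qed
qed

text \<open>Points travel from bottom to top to middle and back, and embedded points follow
  \<open>\<rho>\<close>. \<open>spliced_exists\<close> derives injectivity from this, with
  \<open>\<pi> \<circ> \<pi>\<close> as left inverse.\<close>

lemma spliced_cubic:
  assumes "spliced j v m \<tau> \<rho> \<pi>" "v \<le> m" "\<tau> permutes {..<j}" "\<rho> permutes {..<m}"
    "\<And>x. \<rho> (\<rho> (\<rho> x)) = x" "y < m + 3 * j"
  shows "\<pi> y < m + 3 * j \<and> \<pi> (\<pi> (\<pi> y)) = y"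
proof -
  have E: "\<And>y. y < j \<Longrightarrow> \<pi> y = m + 2 * j + \<tau> y" "\<And>y. y < j \<Longrightarrow> \<pi> (m + 2 * j + y) = v + j + y"
     "\<And>y. y < j \<Longrightarrow> \<pi> (v + j + \<tau> y) = y" "\<And>x. x < m \<Longrightarrow> \<pi> (emb j v x) = emb j v (\<rho> x)"
    using assms(1) by (auto simp: spliced_def)
  have tb: "\<tau> x < j \<longleftrightarrow> x < j" for x using assms(3) by (rule permutes_lessThan_iff)
  have rb: "\<rho> x < m \<longleftrightarrow> x < m" for x using assms(4) by (rule permutes_lessThan_iff)
  \<comment> \<open>The middle block is described at positions \<open>v + j + \<tau> y\<close>, so
    reaching all of it takes surjectivity of \<open>\<tau>\<close>.\<close>
  have K: "\<exists>z<j. x = \<tau> z" if "x < j" for x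
    using that assms(3) permutes_lessThan_iff[OF permutes_inv[OF assms(3)], of x]
    by (intro exI[of _ "inv \<tau> x"]) (auto simp: permutes_inverses)
  from assms(6,2) show ?thesis
  proof (cases rule: splice_position_cases)
    case 1
    then show ?thesis using E(1)[of y] E(2)[of "\<tau> y"] E(3)[of y] tb[of y] by auto
  next
    case (2 x)
    then have "\<pi> y = emb j v (\<rho> x)" using E(4) by simp
    moreover have "emb j v (\<rho> x) < m + 3 * j" using rb[of x] 2 assms(2) by (auto simp: emb_def)
    ultimately show ?thesis using 2 E(4) rb assms(5) by auto
  next
    case (3 x)
    then obtain z where z: "z < j" "x = \<tau> z" using K by blast
    then show ?thesis using 3 E(3)[of z] E(1)[of z] E(2)[of x] by auto
  next
    case (4 x)
    then obtain z where z: "z < j" "x = \<tau> z" using K by blast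
    then show ?thesis using 4 assms(2) E(1)[of z] E(2)[of x] E(3)[of z] by auto
  qed
qed

lemma spliced_exists:
  assumes "v \<le> m" "\<tau> permutes {..<j}" "\<rho> permutes {..<m}" "\<And>x. \<rho> (\<rho> (\<rho> x)) = x"
  shows "\<exists>\<pi>. \<pi> permutes {..<m + 3 * j} \<and> spliced j v m \<tau> \<rho> \<pi>"
proof -
  define \<pi> where "\<pi> = (\<lambda>y. if y < j then m + 2 * j + \<tau> y else if y < v + j then emb j v (\<rho> (y - j))
    else if y < v + 2 * j then inv \<tau> (y - (v + j)) else if y < m + 2 * j then emb j v (\<rho> (y - 2 * j))
    else if y < m + 3 * j then v + j + (y - (m + 2 * j)) else y)"
  have tb: "\<tau> x < j \<longleftrightarrow> x < j" for x using assms(2) by (rule permutes_lessThan_iff)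
  have s: "spliced j v m \<tau> \<rho> \<pi>"
    unfolding spliced_def
  proof (intro conjI allI impI)
    fix y assume y: "y < j"
    show "\<pi> y = m + 2 * j + \<tau> y" using y by (simp add: \<pi>_def)
    show "\<pi> (m + 2 * j + y) = v + j + y" using y assms(1) by (auto simp: \<pi>_def)
    show "\<pi> (v + j + \<tau> y) = y" using y tb[of y] assms(2) by (auto simp: \<pi>_def permutes_inverses)
  next
    fix x assume "x < m"
    then show "\<pi> (emb j v x) = emb j v (\<rho> x)" using assms(1) by (auto simp: \<pi>_def emb_def)
  qed
  note c = spliced_cubic[OF s assms]
  have "\<pi> permutes {..<m + 3 * j}"
  proof (rule permutes_lessThanI)
    show "inj_on \<pi> {..<m + 3 * j}" using c by (intro inj_on_inverseI[of _ "\<lambda>x. \<pi> (\<pi> x)"]) auto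
    show "\<pi> x < m + 3 * j" if "x < m + 3 * j" for x using c that by blast
    show "\<pi> x = x" if "m + 3 * j \<le> x" for x using that assms(1) by (auto simp: \<pi>_def)
  qed
  then show ?thesis using s by blast
qed

text \<open>Here \<open>\<tau> \<in> Av (j - 1)\<close> encodes a pattern on \<open>j\<close> points that fixes the last one.\<close>

locale splice =
  fixes j v m :: nat and \<tau> \<rho> \<pi> :: "nat \<Rightarrow> nat"
  assumes j: "0 < j" and v: "v \<le> m" and \<tau>: "\<tau> \<in> Av (j - 1)" and \<rho>: "\<rho> \<in> Cub m"
    and site: "m - v \<in> sites m \<rho>" and \<pi>: "\<pi> permutes {..<m + 3 * j}" and sp: "spliced j v m \<tau> \<rho> \<pi>"
begin

lemma \<pi>_low: "y < j \<Longrightarrow> \<pi> y = m + 2 * j + \<tau> y"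
  and \<pi>_top: "y < j \<Longrightarrow> \<pi> (m + 2 * j + y) = v + j + y"
  and \<pi>_emb: "x < m \<Longrightarrow> \<pi> (emb j v x) = emb j v (\<rho> x)"
  using sp by (auto simp: spliced_def)

lemma \<tau>_permutes: "\<tau> permutes {..<j}"
  using \<tau> by (rule Av_pred_permutes)

lemma \<tau>_lt: "\<tau> x < j \<longleftrightarrow> x < j"
  using \<tau>_permutes by (rule permutes_lessThan_iff)

lemma inv_\<tau>_lt: "inv \<tau> x < j \<longleftrightarrow> x < j"
  using permutes_inv[OF \<tau>_permutes] by (rule permutes_lessThan_iff)

lemma \<pi>_mid: "y < j \<Longrightarrow> \<pi> (v + j + y) = inv \<tau> y"
  using sp inv_\<tau>_lt[of y] permutes_inverses(1)[OF \<tau>_permutes, of y] by (auto simp: spliced_def)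

lemma \<rho>_permutes: "\<rho> permutes {..<m}"
  and \<rho>_avoids: "avoids132 m \<rho>"
  and \<rho>_cubic: "\<rho> (\<rho> (\<rho> x)) = x"
  using \<rho> by (auto simp: Cub_def Av_def)

lemma \<rho>_lt: "\<rho> x < m \<longleftrightarrow> x < m"
  using \<rho>_permutes by (rule permutes_lessThan_iff)

lemma \<rho>_first: "a < m \<Longrightarrow> a < m - v \<longleftrightarrow> v \<le> \<rho> a"
  and \<rho>_last: "a < m \<Longrightarrow> v \<le> a \<Longrightarrow> \<rho> a < v"
  and \<rho>_mono: "v \<le> a \<Longrightarrow> a < b \<Longrightarrow> b < m \<Longrightarrow> \<rho> a < \<rho> b"
  using site v by (auto simp: sites_def)

text \<open>Each of the first \<open>m - v\<close> positions carries a value of at least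
  \<open>v\<close>, while positions from \<open>v\<close> on carry smaller values, so the two ranges
  are disjoint.\<close>

lemma site_le: "m - v \<le> v"
  using \<rho>_first[of "m - v - 1"] \<rho>_last[of "m - v - 1"] by linarith

lemma emb_bounds: "j \<le> emb j v x" "x < m \<Longrightarrow> emb j v x < m + 2 * j"
  by (auto simp: emb_def)

text \<open>\<open>\<tau>\<close> fixes \<open>j - 1\<close>, so the block length can be read off
  from the position of the maximum.\<close>

lemma \<pi>_max: "\<pi> (j - 1) = m + 3 * j - 1"
proof -
  have "\<tau> (j - 1) = j - 1" using \<tau> by (auto simp: Av_def permutes_not_in)
  then show ?thesis using \<pi>_low[of "j - 1"] j by auto
qed

text \<open>With \<open>j\<close> known, the image of the last position reveals
  \<open>v\<close>.\<close>

lemma \<pi>_last: "\<pi> (m + 3 * j - 1) = v + 2 * j - 1"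
proof -
  have "m + 3 * j - 1 = m + 2 * j + (j - 1)" using j by auto
  then have "\<pi> (m + 3 * j - 1) = v + j + (j - 1)" using \<pi>_top[of "j - 1"] j by simp
  then show ?thesis using j by auto
qed

lemma \<pi>_lt_top:
  assumes "j \<le> y" "y < m + 3 * j" shows "\<pi> y < m + 2 * j"
  using assms(2) v
proof (cases rule: splice_position_cases)
  case (2 x)
  then show ?thesis using \<pi>_emb[of x] emb_bounds(2)[of "\<rho> x"] \<rho>_lt[of x] by auto
next
  case (3 x)
  then show ?thesis using \<pi>_mid[of x] inv_\<tau>_lt[of x] by simp
next
  case (4 x)
  then show ?thesis using \<pi>_top[of x] v by auto
qed (use assms in auto)

text \<open>Values on the bottom block exceed all later ones, so an occurrence starting there lies
  in \<open>\<tau>\<close>. The other occurrences are sorted by the block that contains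
  \<open>c\<close>.\<close>

lemma \<pi>_avoids: "avoids132 (m + 3 * j) \<pi>"
  unfolding avoids132_def
proof (intro allI impI notI)
  fix a b c assume abc: "a < b \<and> b < c \<and> c < m + 3 * j" and val: "\<pi> a < \<pi> c \<and> \<pi> c < \<pi> b"
  show False
  proof (cases "a < j")
    case True
    then have "c < j" using \<pi>_low[of a] \<pi>_lt_top[of c] abc val by fastforce
    then show False
      using avoids132D[OF Av_pred_avoids[OF \<tau>], of a b c] abc val \<pi>_low[of a] \<pi>_low[of b] \<pi>_low[of c]
      by auto
  next
    case False
    then have ja: "j \<le> a" "j \<le> b" "j \<le> c" using abc by auto
    have lt: "a < m + 3 * j" "b < m + 3 * j" "c < m + 3 * j" using abc by auto
    from lt(3) v show False
    proof (cases rule: splice_position_cases)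
      case 1
      then show ?thesis using ja by auto
    next
      \<comment> \<open>Top block: \<open>b\<close> must be an embedded point with value above the
        gap. By the site condition the same then holds for \<open>a\<close>, so
        \<open>\<pi> a\<close> exceeds \<open>\<pi> c\<close>.\<close>
      case (4 x)
      then have pc: "\<pi> c = v + j + x" using \<pi>_top by simp
      from lt(2) v show ?thesis
      proof (cases rule: splice_position_cases)
        case 1
        then show ?thesis using ja by auto
      next
        case (3 y)
        then show ?thesis using \<pi>_mid[of y] inv_\<tau>_lt[of y] pc val by auto
      next
        case (4 y)
        then show ?thesis using \<pi>_top[of y] pc val abc \<open>c = _\<close> by auto
      next
        case (2 y)
        then have "v \<le> \<rho> y" using \<pi>_emb[of y] pc val by (auto simp: emb_def split: if_splits)
        then have y: "y < m - v" using \<rho>_first 2 by auto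
        then have b: "b = y + j" using site_le 2 by (auto simp: emb_def)
        define x' where "x' = a - j"
        have x': "x' < y" "a = emb j v x'" using b ja abc y site_le by (auto simp: x'_def emb_def)
        then have "v \<le> \<rho> x'" using \<rho>_first[of x'] y by auto
        then have "\<pi> a \<ge> v + 2 * j" using \<pi>_emb[of x'] x' y by (auto simp: emb_def)
        then show ?thesis using val pc \<open>x < j\<close> by auto
      qed
    next
      \<comment> \<open>Middle block: the value at \<open>c\<close> is below \<open>j\<close>, which
        forces \<open>a\<close> and hence \<open>b\<close> into the middle block, where the values
        form \<open>inv \<tau>\<close>.\<close>
      case (3 x)
      then have pc: "\<pi> c = inv \<tau> x" "inv \<tau> x < j" using \<pi>_mid inv_\<tau>_lt by auto
      from lt(1) v have "\<exists>y<j. a = v + j + y"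
      proof (cases rule: splice_position_cases)
        case 1
        then show ?thesis using ja by auto
      next
        case (2 y)
        then show ?thesis using \<pi>_emb[of y] emb_bounds[of "\<rho> y"] pc val by auto
      next
        case (4 y)
        then show ?thesis using \<pi>_top[of y] pc val by auto
      qed auto
      then obtain y where y: "y < j" "a = v + j + y" by blast
      define z where "z = b - (v + j)"
      have z: "b = v + j + z" "y < z" "z < x" using abc y 3 by (auto simp: z_def)
      have "inv \<tau> \<in> Av (j - 1)" using \<tau> by (rule Av_inv)
      then show ?thesis
        using avoids132D[OF Av_pred_avoids, of "inv \<tau>" j y z x] val y z 3 pc \<pi>_mid[of y] \<pi>_mid[of z] by auto
    next
      \<comment> \<open>Embedded \<open>c\<close>: then \<open>b\<close> is embedded too. If
        \<open>a\<close> is as well, \<open>\<rho>\<close> contains 132; if \<open>a\<close> is in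
        the middle block, \<open>b\<close> and \<open>c\<close> come after the gap, where
        \<open>\<rho>\<close> increases.\<close>
      case (2 x)
      then have pc: "\<pi> c = emb j v (\<rho> x)" using \<pi>_emb by simp
      from lt(2) v have "\<exists>y<m. b = emb j v y"
      proof (cases rule: splice_position_cases)
        case 1
        then show ?thesis using ja by auto
      next
        case (3 y)
        then show ?thesis using \<pi>_mid[of y] inv_\<tau>_lt[of y] emb_bounds[of "\<rho> x"] pc val by auto
      next
        case (4 y)
        then show ?thesis using 2 emb_bounds(2)[of x] abc by auto
      qed auto
      then obtain y where y: "y < m" "b = emb j v y" by blast
      then have yx: "y < x" using abc 2 emb_less_iff by auto
      have yv: "\<rho> x < \<rho> y" using val pc y \<pi>_emb[of y] emb_less_iff by auto
      from lt(1) v show ?thesis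
      proof (cases rule: splice_position_cases)
        case 1
        then show ?thesis using ja by auto
      next
        case (2 z)
        then have "z < y" "\<rho> z < \<rho> x" using abc y val pc \<pi>_emb[of z] emb_less_iff by auto
        then show ?thesis using avoids132D[OF \<rho>_avoids, of z y x] yx yv \<open>x < m\<close> by auto
      next
        case (3 z)
        then have "v \<le> y" using y abc by (auto simp: emb_def split: if_splits)
        then show ?thesis using \<rho>_mono[of y x] yx yv \<open>x < m\<close> by auto
      next
        case (4 z)
        then show ?thesis using y abc emb_bounds(2)[of y] by auto
      qed
    qed
  qed
qed

lemma \<pi>_Cub: "\<pi> \<in> Cub (m + 3 * j)"
proof -
  have "\<pi> (\<pi> (\<pi> y)) = y" for y
  proof (cases "y < m + 3 * j")
    case True
    then show ?thesis using spliced_cubic[OF sp v \<tau>_permutes \<rho>_permutes \<rho>_cubic] by blast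
  next
    case False
    then show ?thesis using \<pi> by (simp add: permutes_not_in)
  qed
  then show ?thesis using \<pi> \<pi>_avoids by (auto simp: Cub_def Av_def)
qed

section \<open>Sites of the spliced permutation\<close>

lemma emb_shift_iff:
  assumes "t \<le> m - v"
  shows "emb j v a < j + t \<longleftrightarrow> a < t" "m + 3 * j \<le> emb j v b + (j + t) \<longleftrightarrow> m \<le> b + t"
proof -
  \<comment> \<open>The first \<open>j + t\<close> and the last \<open>j + t\<close> points both
    stop short of the middle block, so only an outer block shifts the comparison.\<close>
  have "t \<le> v" "v + t \<le> m" using assms site_le v by auto
  then show "emb j v a < j + t \<longleftrightarrow> a < t" "m + 3 * j \<le> emb j v b + (j + t) \<longleftrightarrow> m \<le> b + t"
    using j by (auto simp: emb_def)
qed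

text \<open>A positive site is at least \<open>j\<close>, as the maximum sits at
  \<open>j - 1\<close>, and cannot pass the insertion gap, as the last position maps to
  \<open>v + 2 * j - 1\<close>. Hence inserting at the \<open>i\<close>-th smallest site leaves
  \<open>i + 1\<close> sites, the rule of the generating tree.\<close>

lemma sites_spliced: "sites (m + 3 * j) \<pi> = insert 0 ((+) j ` {t \<in> sites m \<rho>. t \<le> m - v})" (is "?A = ?B")
proof (intro equalityI subsetI)
  fix u assume u: "u \<in> ?A"
  have u1: "a < u \<longleftrightarrow> m + 3 * j \<le> \<pi> a + u" if "a < m + 3 * j" for a
    using u that by (auto simp: sites_def)
  have u2: "\<pi> a + u < m + 3 * j" if "a < m + 3 * j" "m + 3 * j \<le> a + u" for a
    using u that by (auto simp: sites_def)
  have u3: "\<pi> a < \<pi> b" if "m + 3 * j \<le> a + u" "a < b" "b < m + 3 * j" for a b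
    using u that by (auto simp: sites_def)
  show "u \<in> ?B"
  proof (cases "u = 0")
    case False
    have "j \<le> u" using u1[of "j - 1"] \<pi>_max j False by linarith
    then obtain t where t: "u = j + t" using le_Suc_ex by blast
    have tv: "t \<le> m - v" using u2[of "m + 3 * j - 1"] \<pi>_last t j by linarith
    note sh = emb_shift_iff[OF tv]
    have eb: "emb j v a < m + 3 * j" if "a < m" for a using emb_bounds(2)[OF that] by auto
    have "t \<in> sites m \<rho>"
      unfolding sites_def
    proof (intro CollectI conjI allI impI)
      show "t \<le> m" using tv by auto
    next
      fix a assume a: "a < m"
      show "a < t \<longleftrightarrow> m \<le> \<rho> a + t"
        using u1[OF eb[OF a]] \<pi>_emb[OF a] sh t by auto
    next
      fix a assume a: "a < m" "m \<le> a + t"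
      then show "\<rho> a + t < m" using u2[OF eb[OF a(1)]] \<pi>_emb[OF a(1)] sh(2)[of a] sh(2)[of "\<rho> a"] t by auto
    next
      fix a b assume a: "m \<le> a + t \<and> a < b \<and> b < m"
      then have "\<pi> (emb j v a) < \<pi> (emb j v b)"
        using u3[of "emb j v a" "emb j v b"] eb[of b] sh(2)[of a] emb_less_iff t by auto
      then show "\<rho> a < \<rho> b" using \<pi>_emb a emb_less_iff by auto
    qed
    then show ?thesis using t tv by auto
  qed simp
next
  fix u assume "u \<in> ?B"
  then consider "u = 0" | t where "t \<in> sites m \<rho>" "t \<le> m - v" "u = j + t" by auto
  then show "u \<in> ?A"
  proof cases
    case 1
    then show ?thesis using permutes_lessThan_iff[OF \<pi>] by (auto simp: sites_def not_le)
  next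
    case 2
    note sh = emb_shift_iff[OF 2(2)]
    have tv: "v + t \<le> m" "t \<le> v" using 2 v site_le by auto
    have t1: "a < t \<longleftrightarrow> m \<le> \<rho> a + t" if "a < m" for a
      using 2(1) that by (auto simp: sites_def)
    have t2: "\<rho> a + t < m" if "a < m" "m \<le> a + t" for a
      using 2(1) that by (auto simp: sites_def)
    have t3: "\<rho> a < \<rho> b" if "m \<le> a + t" "a < b" "b < m" for a b
      using 2(1) that by (auto simp: sites_def)
    show ?thesis
      unfolding sites_def 2(3)
    proof (intro CollectI conjI allI impI)
      show "j + t \<le> m + 3 * j" using 2 by auto
    next
      fix a assume "a < m + 3 * j"
      then show "a < j + t \<longleftrightarrow> m + 3 * j \<le> \<pi> a + (j + t)" using v
      proof (cases rule: splice_position_cases)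
        case 1
        then show ?thesis using \<pi>_low[of a] by auto
      next
        case (2 x)
        then show ?thesis using \<pi>_emb[of x] sh t1[of x] by auto
      next
        case (3 x)
        then show ?thesis using \<pi>_mid[of x] inv_\<tau>_lt[of x] tv by auto
      next
        case (4 x)
        then show ?thesis using \<pi>_top[of x] tv by auto
      qed
    next
      fix a assume a': "a < m + 3 * j" and a: "m + 3 * j \<le> a + (j + t)"
      from a' v show "\<pi> a + (j + t) < m + 3 * j"
      proof (cases rule: splice_position_cases)
        case (2 x)
        then show ?thesis using \<pi>_emb[of x] a sh(2)[of x] sh(2)[of "\<rho> x"] t2[of x] by auto
      next
        case (4 x)
        then show ?thesis using \<pi>_top[of x] tv by auto
      qed (use a tv in auto)
    next
      fix a b assume ab: "m + 3 * j \<le> a + (j + t) \<and> a < b \<and> b < m + 3 * j"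
      then have "b < m + 3 * j" by auto
      then show "\<pi> a < \<pi> b" using v
      proof (cases rule: splice_position_cases)
        case (2 y)
        have "a < m + 3 * j" using ab by auto
        then show ?thesis using v
        proof (cases rule: splice_position_cases)
          case (2 x)
          then have "m \<le> x + t" "x < y" using ab sh(2)[of x] emb_less_iff \<open>b = _\<close> by auto
          then show ?thesis using 2 \<open>b = _\<close> \<open>y < m\<close> t3[of x y] \<pi>_emb emb_less_iff by auto
        next
          case (4 x)
          then show ?thesis using ab \<open>b = _\<close> emb_bounds(2)[OF \<open>y < m\<close>] by auto
        qed (use ab tv in auto)
      next
        case (4 y)
        have "a < m + 3 * j" using ab by auto
        then show ?thesis using v
        proof (cases rule: splice_position_cases)
          case (2 x)
          then have "v \<le> x" using ab sh(2)[of x] tv by auto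
          then have "\<rho> x < v" using \<rho>_last 2 by auto
          then show ?thesis using \<pi>_emb[of x] \<pi>_top[of y] 2 4 by (auto simp: emb_def)
        next
          case (4 x)
          then show ?thesis using \<pi>_top[of x] \<pi>_top[of y] \<open>b = _\<close> \<open>y < j\<close> ab by auto
        qed (use ab tv in auto)
      qed (use ab tv in auto)
    qed
  qed
qed

lemma card_sites_spliced: "card (sites (m + 3 * j) \<pi>) = Suc (card {t \<in> sites m \<rho>. t \<le> m - v})"
proof -
  have "finite {t \<in> sites m \<rho>. t \<le> m - v}" by (rule finite_subset[of _ "{..m - v}"]) auto
  then show ?thesis unfolding sites_spliced using j by (subst card_insert_disjoint) (auto simp: card_image)
qed

end

section \<open>Decomposition and counting\<close>

lemma CubD:
  assumes "\<pi> \<in> Cub n"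
  shows "\<pi> \<in> Av n" "\<pi> permutes {..<n}" "avoids132 n \<pi>" "\<pi> (\<pi> (\<pi> x)) = x"
  using assms by (auto simp: Cub_def Av_def)

lemma Cub_eq_iff: "\<pi> \<in> Cub n \<Longrightarrow> \<pi> x = \<pi> y \<longleftrightarrow> x = y"
  using permutes_inj[OF CubD(2)] by (auto dest: injD)

lemma Cub_square:
  assumes "\<pi> \<in> Cub n" shows "\<pi> \<circ> \<pi> \<in> Cub n"
proof -
  have "inv \<pi> = \<pi> \<circ> \<pi>" using CubD(4)[OF assms] by (intro inv_unique_comp) auto
  then show ?thesis using Av_inv[OF CubD(1)[OF assms]] CubD(4)[OF assms] by (auto simp: Cub_def)
qed

text \<open>The cycle through the last point is \<open>J\<close>, \<open>N\<close>,
  \<open>k\<close>. Applying \<open>Av_before_max\<close> to \<open>\<pi>\<close> and to its inverse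
  \<open>\<pi> \<circ> \<pi>\<close> locates the bottom block and the positions of the values up to
  \<open>k\<close>. The top block then maps increasingly onto consecutive values ending at
  \<open>k\<close>, the middle block, and the remaining points carry \<open>\<rho>\<close>.\<close>

lemma splice_of_Cub:
  assumes C: "\<pi> \<in> Cub n" and n: "0 < n" and less: "\<pi> (\<pi> (n - 1)) < \<pi> (n - 1)"
  obtains v m \<tau> \<rho> where "n = m + 3 * Suc (\<pi> (\<pi> (n - 1)))" "splice (Suc (\<pi> (\<pi> (n - 1)))) v m \<tau> \<rho> \<pi>"
proof -
  obtain N where N: "n = Suc N" using n gr0_implies_Suc by blast
  define k where "k = \<pi> N"
  define J where "J = \<pi> k"
  note p = CubD(2)[OF C] and av = CubD(3)[OF C] and cub = CubD(4)[OF C]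
  have inj: "\<pi> x = \<pi> y \<longleftrightarrow> x = y" for x y using C by (rule Cub_eq_iff)
  have bd: "\<pi> x \<le> N \<longleftrightarrow> x \<le> N" for x using permutes_lessThan_iff[OF p, of x] N by auto
  have piJ: "\<pi> J = N" using cub by (simp add: J_def k_def)
  have Jk: "J < k" using less N by (simp add: J_def k_def)
  have "k \<le> N" using bd by (simp add: k_def)
  have seg1: "a \<le> J \<longleftrightarrow> N \<le> \<pi> a + J" if "a \<le> N" for a
    using Av_before_max[of \<pi> N J a] CubD(1)[OF C] N piJ that Jk \<open>k \<le> N\<close> by auto
  \<comment> \<open>\<open>\<pi> \<circ> \<pi>\<close> has its maximum at \<open>k\<close>, since
    \<open>\<pi> (\<pi> k) = \<pi> J = N\<close>. Evaluation at position \<open>\<pi> y\<close>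
    gives a statement about \<open>y\<close>.\<close>
  have seg2: "\<pi> y \<le> k \<longleftrightarrow> N \<le> y + k" if "y \<le> N" for y
    using Av_before_max[of "\<pi> \<circ> \<pi>" N k "\<pi> y"] CubD(1)[OF Cub_square[OF C]] N piJ that \<open>k \<le> N\<close> bd[of y] cub[of y]
    by (auto simp: J_def)
  have Jk2: "J + k < N" using seg2[of J] piJ Jk \<open>k \<le> N\<close> by (cases "k = N") (auto simp: J_def k_def)
  have sq_low: "\<pi> (\<pi> y) \<le> J" if "y \<le> N" "N \<le> y + J" for y
    using seg1[of "\<pi> (\<pi> y)"] that cub[of y] bd by auto
  have top_not_low: "J < \<pi> y" if "y \<le> N" "N \<le> y + J" for y
  proof (rule ccontr)
    assume "\<not> J < \<pi> y"
    then have "N \<le> \<pi> (\<pi> y) + J" using seg1[of "\<pi> y"] that bd by auto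
    then show False using sq_low[OF that] Jk Jk2 by linarith
  qed
  \<comment> \<open>Otherwise positions \<open>k < a < b\<close> form 132, because
    \<open>\<pi> k = J\<close> is below all values on the top block.\<close>
  have inc: "\<pi> a < \<pi> b" if "N \<le> a + J" "a < b" "b \<le> N" for a b
  proof (rule ccontr)
    assume "\<not> \<pi> a < \<pi> b"
    then have "\<pi> b < \<pi> a" using inj[of a b] that by linarith
    moreover have "\<pi> k < \<pi> b" using top_not_low[of b] that by (simp add: J_def)
    moreover have "k < a" using that Jk2 by linarith
    ultimately show False using avoids132D[OF av, of k a b] that N by auto
  qed
  \<comment> \<open>A gap \<open>x\<close> between consecutive values on the top block would form a 132 pattern at positions
    \<open>\<pi> y < x < k\<close>, since \<open>\<pi> k = J\<close> is the largest value below \<open>j\<close>.\<close>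
  have step: "\<pi> (Suc y) = Suc (\<pi> y)" if y: "N \<le> y + J" "y < N" for y
  proof (rule ccontr)
    assume ne: "\<pi> (Suc y) \<noteq> Suc (\<pi> y)"
    define x where "x = Suc (\<pi> y)"
    have x1: "x < \<pi> (Suc y)" using inc[of y "Suc y"] y ne by (auto simp: x_def)
    have "\<pi> (Suc y) \<le> k" using seg2[of "Suc y"] y Jk by auto
    then have x2: "x < k" using x1 by auto
    have "\<pi> (\<pi> y) \<noteq> J" using inj[of "\<pi> y" k] x2 by (auto simp: J_def x_def)
    then have l: "\<pi> (\<pi> y) < J" using sq_low[of y] y by auto
    show False
    proof (cases "\<pi> x \<le> J")
      \<comment> \<open>Here \<open>x\<close> is itself a value on the top block, at position
        \<open>w\<close>; monotonicity would put \<open>w\<close> strictly between \<open>y\<close>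
        and \<open>Suc y\<close>.\<close>
      case True
      define w where "w = \<pi> (\<pi> x)"
      have pw: "\<pi> w = x" using cub by (simp add: w_def)
      have "\<pi> x \<le> N" "w \<le> N" using x2 \<open>k \<le> N\<close> bd by (auto simp: w_def)
      then have "N \<le> w + J" using seg1[of "\<pi> x"] True by (auto simp: w_def)
      then have "\<not> w < y" "\<not> Suc y < w" "w \<noteq> y" "w \<noteq> Suc y"
        using inc[of w y] inc[of "Suc y" w] \<open>w \<le> N\<close> y x1 pw by (auto simp: x_def)
      then show False by linarith
    next
      case False
      then show False using avoids132D[OF av, of "\<pi> y" x k] l x2 \<open>k \<le> N\<close> N by (auto simp: x_def J_def)
    qed
  qed
  have top: "t \<le> J \<Longrightarrow> \<pi> (N - t) + t = k" for t
  proof (induction t)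
    case (Suc t)
    then have "Suc (N - Suc t) = N - t" using Jk Jk2 by linarith
    then show ?case using Suc step[of "N - Suc t"] Jk Jk2 by auto
  qed (simp add: k_def)
  \<comment> \<open>The lowest top position \<open>N - J\<close> maps to \<open>k - J\<close>, which
    lies above the bottom block. So bottom and middle block are disjoint, and \<open>v\<close>
    counts the points between them.\<close>
  have "2 * J < k" using top[of J] top_not_low[of "N - J"] Jk Jk2 by simp
  then obtain v where kv: "k = v + 2 * J + 1"
    using le_Suc_ex[of "2 * J + 1" k] by (auto simp: add.commute add.left_commute)
  define m where "m = N - (3 * J + 2)"
  have Nm: "N = m + 3 * J + 2" and vm: "v \<le> m" using Jk2 kv by (auto simp: m_def)
  define j where "j = Suc J"
  have nm: "n = m + 3 * j" using N Nm by (simp add: j_def)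
  have topj: "\<pi> (m + 2 * j + y) = v + j + y" if "y < j" for y
  proof -
    have "m + 2 * j + y = N - (J - y)" using that Nm by (auto simp: j_def)
    then have "\<pi> (m + 2 * j + y) + (J - y) = k" using top[of "J - y"] by simp
    then show ?thesis using that kv by (auto simp: j_def)
  qed
  have lowj: "m + 2 * j \<le> \<pi> y" if "y < j" for y using seg1[of y] that Nm by (auto simp: j_def)
  define \<tau> where "\<tau> = (\<lambda>y. if y < J then \<pi> y - (m + 2 * j) else y)"
  have low: "\<pi> y = m + 2 * j + \<tau> y" if "y < j" for y
    using lowj[of y] that piJ Nm by (cases "y = J") (auto simp: \<tau>_def j_def)
  have \<tau>J: "\<tau> y < J" if "y < J" for y
  proof -
    have "\<pi> y \<le> N" "\<pi> y \<noteq> N" using that bd[of y] inj[of y J] piJ Jk Jk2 by auto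
    then show ?thesis using low[of y] that Nm by (auto simp: j_def)
  qed
  have \<tau>: "\<tau> \<in> Av (j - 1)"
  proof -
    have "\<tau> permutes {..<J}"
    proof (rule permutes_lessThanI)
      show "inj_on \<tau> {..<J}"
      proof (rule inj_onI)
        fix x y assume "x \<in> {..<J}" "y \<in> {..<J}" "\<tau> x = \<tau> y"
        then show "x = y" using low[of x] low[of y] inj[of x y] by (auto simp: j_def)
      qed
    qed (use \<tau>J in \<open>auto simp: \<tau>_def\<close>)
    moreover have "avoids132 J \<tau>"
      unfolding avoids132_def
    proof (intro allI impI notI)
      fix a b c assume "a < b \<and> b < c \<and> c < J" "\<tau> a < \<tau> c \<and> \<tau> c < \<tau> b"
      then show False using avoids132D[OF av, of a b c] low[of a] low[of b] low[of c] nm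
        by (auto simp: j_def)
    qed
    ultimately show ?thesis by (auto simp: Av_def j_def)
  qed
  have \<tau>j: "\<tau> y < j" if "y < j" for y
    using \<tau>J[of y] that by (cases "y = J") (auto simp: j_def \<tau>_def)
  have mid: "\<pi> (v + j + \<tau> y) = y" if "y < j" for y
    using topj[OF \<tau>j[OF that]] low[OF that] cub[of y] by simp
  \<comment> \<open>The three blocks are mapped among themselves, so the other points are as
    well.\<close>
  have ex: "\<exists>x'<m. \<pi> (emb j v x) = emb j v x'" if x: "x < m" for x
  proof -
    have e: "j \<le> emb j v x" "emb j v x < m + 2 * j" using x by (auto simp: emb_def)
    have "\<pi> (emb j v x) < m + 3 * j" using bd[of "emb j v x"] e nm N by auto
    then show ?thesis using vm
    proof (cases rule: splice_position_cases)
      case 1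
      then have "emb j v x = v + j + \<tau> (\<pi> (emb j v x))"
        using cub[of "emb j v x"] low[OF 1] topj[OF \<tau>j[OF 1]] by simp
      then show ?thesis using \<tau>j[OF 1] by (auto simp: emb_def split: if_splits)
    next
      case (3 y)
      then have "emb j v x = m + 2 * j + y" using topj[of y] inj[of "emb j v x" "m + 2 * j + y"] by simp
      then show ?thesis using e by auto
    next
      case (4 y)
      then show ?thesis using seg1[of "emb j v x"] e Nm by (auto simp: j_def)
    qed auto
  qed
  then obtain r where r: "\<And>x. x < m \<Longrightarrow> r x < m \<and> \<pi> (emb j v x) = emb j v (r x)" by metis
  define \<rho> where "\<rho> = (\<lambda>x. if x < m then r x else x)"
  have emb: "\<pi> (emb j v x) = emb j v (\<rho> x)" "\<rho> x < m" if "x < m" for x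
    using r[OF that] that by (auto simp: \<rho>_def)
  have "\<rho> (\<rho> (\<rho> x)) = x" for x
  proof (cases "x < m")
    case True
    then have "emb j v (\<rho> (\<rho> (\<rho> x))) = emb j v x" 
      using emb(1)[OF True] emb(1)[OF emb(2)[OF True]] emb(1)[OF emb(2)[OF emb(2)[OF True]]]
        cub[of "emb j v x"] by simp
    then show ?thesis by (simp add: emb_eq_iff)
  qed (simp add: \<rho>_def)
  moreover have "\<rho> permutes {..<m}"
  proof (rule permutes_lessThanI)
    show "inj_on \<rho> {..<m}"
      by (rule inj_on_inverseI[of _ "\<lambda>x. \<rho> (\<rho> x)"]) (rule calculation)
  qed (use emb in \<open>auto simp: \<rho>_def\<close>)
  moreover have "avoids132 m \<rho>"
    unfolding avoids132_def
  proof (intro allI impI notI)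
    fix a b c assume h: "a < b \<and> b < c \<and> c < m" "\<rho> a < \<rho> c \<and> \<rho> c < \<rho> b"
    have "emb j v c < n" using h nm by (auto simp: emb_def)
    then show False using avoids132D[OF av, of "emb j v a" "emb j v b" "emb j v c"] h emb(1)
      by (auto simp: emb_less_iff)
  qed
  ultimately have \<rho>: "\<rho> \<in> Cub m" by (auto simp: Cub_def Av_def)
  \<comment> \<open>\<open>v + j\<close> is the image of the top point \<open>m + 2 * j\<close>, so
    its own image is in the bottom block.\<close>
  have "\<pi> (v + j) \<le> J" using sq_low[of "m + 2 * j"] topj[of 0] Nm by (auto simp: j_def)
  then have m2v: "m \<le> 2 * v" using seg2[of "v + j"] Jk Nm kv vm by (auto simp: j_def)
  have first: "a < m - v \<longleftrightarrow> v \<le> \<rho> a" if a: "a < m" for a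
  proof -
    have "emb j v a \<le> N" using a Nm by (auto simp: emb_def j_def)
    then have "emb j v (\<rho> a) \<le> k \<longleftrightarrow> N \<le> emb j v a + k" using seg2[of "emb j v a"] emb(1)[OF a] by simp
    moreover have "emb j v (\<rho> a) \<le> k \<longleftrightarrow> \<rho> a < v" using kv by (auto simp: emb_def j_def)
    moreover have "N \<le> emb j v a + k \<longleftrightarrow> m - v \<le> a" using kv Nm m2v by (auto simp: emb_def j_def)
    ultimately show ?thesis by auto
  qed
  \<comment> \<open>A descent would form 132 with position \<open>k\<close>, the end of the middle
    block, whose value \<open>J\<close> is below every embedded value.\<close>
  have mono: "\<rho> a < \<rho> b" if h: "v \<le> a" "a < b" "b < m" for a b
  proof (rule ccontr)
    assume "\<not> \<rho> a < \<rho> b"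
    moreover have "\<pi> (emb j v a) \<noteq> \<pi> (emb j v b)" using inj[of "emb j v a" "emb j v b"] emb_eq_iff h by auto
    then have "\<rho> a \<noteq> \<rho> b" using emb(1)[of a] emb(1)[of b] h by auto
    ultimately have "\<pi> (emb j v b) < \<pi> (emb j v a)" using emb(1)[of a] emb(1)[of b] h by (simp add: emb_less_iff)
    moreover have "k < emb j v a" using h kv by (auto simp: emb_def j_def)
    moreover have "\<pi> k < \<pi> (emb j v b)" using emb(1)[of b] h by (auto simp: J_def[symmetric] emb_def j_def)
    moreover have "emb j v b < n" using h nm by (auto simp: emb_def)
    ultimately show False using avoids132D[OF av, of k "emb j v a" "emb j v b"] h by (auto simp: emb_less_iff)
  qed
  have "m - v \<in> sites m \<rho>"
    unfolding sites_def
  proof (intro CollectI conjI allI impI)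
    show "m - v \<le> m" by simp
    show "a < m - v \<longleftrightarrow> m \<le> \<rho> a + (m - v)" if "a < m" for a using first[OF that] vm by linarith
    show "\<rho> a + (m - v) < m" if "a < m" "m \<le> a + (m - v)" for a
      using first[OF that(1)] that(2) vm m2v by linarith
    show "\<rho> a < \<rho> b" if "m \<le> a + (m - v) \<and> a < b \<and> b < m" for a b
      using mono[of a b] that vm by linarith
  qed
  then have "splice j v m \<tau> \<rho> \<pi>"
    using \<tau> \<rho> vm p nm low topj mid emb(1) by unfold_locales (auto simp: spliced_def j_def)
  moreover have "Suc (\<pi> (\<pi> (n - 1))) = j" using N by (simp add: j_def J_def k_def)
  ultimately show ?thesis by (intro that[of m v \<tau> \<rho>]) (simp_all only: nm)
qed

section \<open>Enumeration by the number of sites\<close>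

lemma finite_sites [simp]: "finite (sites n p)"
  by (rule finite_subset[of _ "{..n}"]) (auto simp: sites_def)

lemma zero_in_sites: "p permutes {..<n} \<Longrightarrow> 0 \<in> sites n p"
  using permutes_lessThan_iff[of p n] by (auto simp: sites_def not_le)

text \<open>The position \<open>J\<close> of the maximum is among the first \<open>u\<close>. If
  \<open>k = \<pi> (n - 1)\<close> were too, its image \<open>J\<close> would be one of the top
  \<open>u\<close> values, although \<open>J < u\<close> and \<open>2 * u \<le> n\<close>.\<close>

lemma pos_site_imp_less:
  assumes C: "\<pi> \<in> Cub n" and u: "u \<in> sites n \<pi>" "0 < u"
  shows "0 < n" "\<pi> (\<pi> (n - 1)) < \<pi> (n - 1)"
proof -
  note p = CubD(2)[OF C] and cub = CubD(4)[OF C]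
  have un: "u \<le> n" using u by (auto simp: sites_def)
  then show n: "0 < n" using u by auto
  have u1: "a < u \<longleftrightarrow> n \<le> \<pi> a + u" if "a < n" for a using u(1) that by (auto simp: sites_def)
  have u2: "\<pi> a + u < n" if "a < n" "n \<le> a + u" for a using u(1) that by (auto simp: sites_def)
  define k where "k = \<pi> (n - 1)"
  define J where "J = \<pi> k"
  have b: "k < n" "J < n" using permutes_lessThan_iff[OF p] n by (auto simp: k_def J_def)
  have piJ: "\<pi> J = n - 1" using cub by (simp add: J_def k_def)
  have J: "J < u" using u1[of J] b piJ u(2) by linarith
  have "2 * u \<le> n" using u1[of "u - 1"] u2[of "u - 1"] un u(2) by linarith
  then have "\<not> k < u" using u1[of k] b J by (simp add: J_def)
  then show "\<pi> (\<pi> (n - 1)) < \<pi> (n - 1)" using J by (simp add: J_def k_def)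
qed

text \<open>A splice adds the site 0 to at least one inherited site, so the number of sites tells
  whether a permutation arises from a splice.\<close>

lemma two_sites_iff:
  assumes C: "\<pi> \<in> Cub n"
  shows "2 \<le> card (sites n \<pi>) \<longleftrightarrow> 0 < n \<and> \<pi> (\<pi> (n - 1)) < \<pi> (n - 1)"
proof
  assume c: "2 \<le> card (sites n \<pi>)"
  have "\<exists>u\<in>sites n \<pi>. 0 < u"
  proof (rule ccontr)
    assume "\<not> ?thesis"
    then have "sites n \<pi> \<subseteq> {0}" by auto
    then show False using card_mono[of "{0::nat}" "sites n \<pi>"] c by auto
  qed
  then obtain u where u: "u \<in> sites n \<pi>" "0 < u" by blast
  show "0 < n \<and> \<pi> (\<pi> (n - 1)) < \<pi> (n - 1)" using pos_site_imp_less[OF C u] by simp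
next
  assume "0 < n \<and> \<pi> (\<pi> (n - 1)) < \<pi> (n - 1)"
  then have h: "0 < n" "\<pi> (\<pi> (n - 1)) < \<pi> (n - 1)" by auto
  obtain v m \<tau> \<rho> where n: "n = m + 3 * Suc (\<pi> (\<pi> (n - 1)))" and s: "splice (Suc (\<pi> (\<pi> (n - 1)))) v m \<tau> \<rho> \<pi>"
    by (rule splice_of_Cub[OF C h])
  interpret splice "Suc (\<pi> (\<pi> (n - 1)))" v m \<tau> \<rho> \<pi> by (rule s)
  have "card {t \<in> sites m \<rho>. t \<le> m - v} \<noteq> 0"
    using site by (subst card_eq_0_iff) auto
  moreover have "card (sites n \<pi>) = Suc (card {t \<in> sites m \<rho>. t \<le> m - v})"
    using card_sites_spliced n by simp
  ultimately show "2 \<le> card (sites n \<pi>)" by linarith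
qed

text \<open>"At least" is the useful form: each \<open>\<rho>\<close> with at least \<open>l\<close>
  sites has exactly one whose use leaves \<open>l + 1\<close> sites, namely the \<open>l\<close>-th
  smallest.\<close>

definition sites_count :: "nat \<Rightarrow> nat \<Rightarrow> nat" where
  "sites_count l n = card {\<pi> \<in> Cub n. l \<le> card (sites n \<pi>)}"

lemma sites_count_one: "sites_count 1 n = card (Cub n)"
proof -
  have "1 \<le> card (sites n \<pi>)" if "\<pi> \<in> Cub n" for \<pi>
    using zero_in_sites[OF CubD(2)[OF that]] card_gt_0_iff[of "sites n \<pi>"] by auto
  then have "{\<pi> \<in> Cub n. 1 \<le> card (sites n \<pi>)} = Cub n" by auto
  then show ?thesis by (simp add: sites_count_def)
qed

lemma sites_count_eq_0: "Suc n < l \<Longrightarrow> sites_count l n = 0"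
proof -
  assume l: "Suc n < l"
  have "card (sites n \<pi>) \<le> Suc n" for \<pi>
    using card_mono[of "{..n}" "sites n \<pi>"] by (auto simp: sites_def)
  then have "{\<pi> \<in> Cub n. l \<le> card (sites n \<pi>)} = {}" using l by (auto simp: not_le intro: le_less_trans)
  then show ?thesis by (simp add: sites_count_def)
qed

lemma ex_initial_segment_card:
  fixes S :: "nat set"
  assumes "finite S" "1 \<le> l" "l \<le> card S"
  shows "\<exists>s\<in>S. card {t \<in> S. t \<le> s} = l"
  using assms
proof (induction "card S" arbitrary: S)
  case (Suc c)
  have ne: "S \<noteq> {}" using Suc by auto
  show ?case
  proof (cases "l = card S")
    case True
    have "{t \<in> S. t \<le> Max S} = S" using Suc ne by auto
    then show ?thesis using True Max_in[OF Suc(3) ne] by metis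
  next
    case False
    let ?S = "S - {Max S}"
    have "c = card ?S" using Suc Max_in[OF Suc(3) ne] by simp
    moreover from this have "l \<le> card ?S" using False Suc by simp
    ultimately obtain s where s: "s \<in> ?S" "card {t \<in> ?S. t \<le> s} = l"
      using Suc(1)[of ?S] Suc(3,4) by auto
    have "s < Max S" using s Max_ge[OF Suc(3), of s] by force
    then have "{t \<in> ?S. t \<le> s} = {t \<in> S. t \<le> s}" by auto
    then show ?thesis using s by auto
  qed
qed simp

text \<open>Once \<open>l\<close> is fixed, \<open>\<tau>\<close> and \<open>\<rho>\<close>
  determine \<open>\<pi>\<close>, because the site used must be the \<open>l\<close>-th smallest one
  of \<open>\<rho>\<close>.\<close>

lemma card_Cub_max_at:
  assumes j: "0 < j" and l: "1 \<le> l" and n: "n = m + 3 * j"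
  shows "card {\<pi> \<in> Cub n. \<pi> (j - 1) = n - 1 \<and> card (sites n \<pi>) = Suc l} = card (Av (j - 1)) * sites_count l m"
proof -
  let ?X = "{\<pi> \<in> Cub n. \<pi> (j - 1) = n - 1 \<and> card (sites n \<pi>) = Suc l}"
  let ?Y = "Av (j - 1) \<times> {\<rho> \<in> Cub m. l \<le> card (sites m \<rho>)}"
  let ?R = "\<lambda>\<pi> (\<tau>, \<rho>). \<exists>v. splice j v m \<tau> \<rho> \<pi> \<and> card {t \<in> sites m \<rho>. t \<le> m - v} = l"
  have "card ?X = card ?Y"
  proof (rule card_eq_via_relation[where R = ?R])
    fix \<pi> assume "\<pi> \<in> ?X"
    then have C: "\<pi> \<in> Cub n" and pj: "\<pi> (j - 1) = n - 1" and c: "card (sites n \<pi>) = Suc l" by auto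
    have h: "0 < n" "\<pi> (\<pi> (n - 1)) < \<pi> (n - 1)" using two_sites_iff[OF C] c l by auto
    obtain v m' \<tau> \<rho> where n': "n = m' + 3 * Suc (\<pi> (\<pi> (n - 1)))"
      and s: "splice (Suc (\<pi> (\<pi> (n - 1)))) v m' \<tau> \<rho> \<pi>"
      by (rule splice_of_Cub[OF C h])
    have "\<pi> (\<pi> (n - 1)) = j - 1" using CubD(4)[OF C, of "j - 1"] pj by simp
    then have j': "Suc (\<pi> (\<pi> (n - 1))) = j" using j by simp
    then have m': "m' = m" using n n' by simp
    have s: "splice j v m \<tau> \<rho> \<pi>" using s j' m' by simp
    then interpret splice j v m \<tau> \<rho> \<pi> .
    have c': "card {t \<in> sites m \<rho>. t \<le> m - v} = l" using card_sites_spliced c n by simp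
    moreover have "card {t \<in> sites m \<rho>. t \<le> m - v} \<le> card (sites m \<rho>)" by (rule card_mono) auto
    ultimately have "(\<tau>, \<rho>) \<in> ?Y" using \<tau> \<rho> by simp
    moreover have "?R \<pi> (\<tau>, \<rho>)" unfolding prod.case using s c' by (intro exI[of _ v] conjI)
    ultimately show "\<exists>y\<in>?Y. ?R \<pi> y" by (rule bexI[rotated])
  next
    fix y assume "y \<in> ?Y"
    then obtain \<tau> \<rho> where y: "y = (\<tau>, \<rho>)" and \<tau>: "\<tau> \<in> Av (j - 1)" and \<rho>: "\<rho> \<in> Cub m" and c: "l \<le> card (sites m \<rho>)"
      by auto
    obtain s where s: "s \<in> sites m \<rho>" "card {t \<in> sites m \<rho>. t \<le> s} = l"
      using ex_initial_segment_card[OF _ l c] by auto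
    then have sm: "m - (m - s) = s" by (auto simp: sites_def)
    obtain \<pi> where \<pi>: "\<pi> permutes {..<m + 3 * j}" "spliced j (m - s) m \<tau> \<rho> \<pi>"
      using spliced_exists[OF diff_le_self Av_pred_permutes[OF \<tau>] CubD(2,4)[OF \<rho>]] by blast
    interpret splice j "m - s" m \<tau> \<rho> \<pi>
      by unfold_locales (use j \<tau> \<rho> s(1) \<pi> in \<open>simp_all add: sm\<close>)
    have "\<pi> \<in> ?X" using \<pi>_Cub \<pi>_max card_sites_spliced s(2) by (simp add: sm n)
    moreover have "?R \<pi> y"
      using splice_axioms s(2) unfolding y prod.case by (intro exI[of _ "m - s"]) (simp add: sm)
    ultimately show "\<exists>\<pi>\<in>?X. ?R \<pi> y" by (intro bexI[where x = \<pi>])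
  next
    fix \<pi> y y' assume h: "?R \<pi> y" "?R \<pi> y'"
    obtain \<tau> \<rho> where y: "y = (\<tau>, \<rho>)" by (rule prod.exhaust)
    obtain \<tau>' \<rho>' where y': "y' = (\<tau>', \<rho>')" by (rule prod.exhaust)
    obtain v where "splice j v m \<tau> \<rho> \<pi>" using h(1) unfolding y prod.case by (elim exE conjE)
    then interpret A: splice j v m \<tau> \<rho> \<pi> .
    obtain v' where "splice j v' m \<tau>' \<rho>' \<pi>" using h(2) unfolding y' prod.case by (elim exE conjE)
    then interpret B: splice j v' m \<tau>' \<rho>' \<pi> .
    have v: "v = v'" using A.\<pi>_last B.\<pi>_last j by linarith
    have "\<tau> = \<tau>'"
    proof (rule permutes_eqI[OF A.\<tau>_permutes B.\<tau>_permutes])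
      fix x assume "x < j"
      then show "\<tau> x = \<tau>' x" using A.\<pi>_low[of x] B.\<pi>_low[of x] by simp
    qed
    moreover have "\<rho> = \<rho>'"
    proof (rule permutes_eqI[OF A.\<rho>_permutes B.\<rho>_permutes])
      fix x assume "x < m"
      then show "\<rho> x = \<rho>' x"
        using A.\<pi>_emb[of x] B.\<pi>_emb[of x] v emb_eq_iff[of j v "\<rho> x" "\<rho>' x"] by simp
    qed
    ultimately show "y = y'" using y y' by simp
  next
    fix \<pi> \<pi>' y assume h: "?R \<pi> y" "?R \<pi>' y"
    obtain \<tau> \<rho> where y: "y = (\<tau>, \<rho>)" by (rule prod.exhaust)
    obtain v where v: "splice j v m \<tau> \<rho> \<pi>" "card {t \<in> sites m \<rho>. t \<le> m - v} = l"
      using h(1) unfolding y prod.case by (elim exE conjE)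
    obtain v' where v': "splice j v' m \<tau> \<rho> \<pi>'" "card {t \<in> sites m \<rho>. t \<le> m - v'} = l"
      using h(2) unfolding y prod.case by (elim exE conjE)
    interpret A: splice j v m \<tau> \<rho> \<pi> by (rule v)
    interpret B: splice j v' m \<tau> \<rho> \<pi>' by (rule v')
    \<comment> \<open>Distinct sites have distinct ranks, so \<open>l\<close> determines the site
      and thereby \<open>v\<close>.\<close>
    have *: False if "s < s'" "s' \<in> sites m \<rho>" "card {t \<in> sites m \<rho>. t \<le> s} = card {t \<in> sites m \<rho>. t \<le> s'}" for s s'
    proof -
      have "{t \<in> sites m \<rho>. t \<le> s} \<subseteq> {t \<in> sites m \<rho>. t \<le> s'}" "s' \<in> {t \<in> sites m \<rho>. t \<le> s'}"
        "s' \<notin> {t \<in> sites m \<rho>. t \<le> s}" using that by auto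
      then have "{t \<in> sites m \<rho>. t \<le> s} \<subset> {t \<in> sites m \<rho>. t \<le> s'}" by blast
      then have "card {t \<in> sites m \<rho>. t \<le> s} < card {t \<in> sites m \<rho>. t \<le> s'}"
        by (intro psubset_card_mono) simp_all
      then show False using that(3) by simp
    qed
    have "m - v = m - v'"
    proof (rule linorder_cases[of "m - v" "m - v'"])
      assume "m - v < m - v'"
      then show ?thesis using *[OF _ B.site] v(2) v'(2) by simp
    next
      assume "m - v' < m - v"
      then show ?thesis using *[OF _ A.site] v(2) v'(2) by simp
    qed assumption
    then have vv: "v = v'" using A.v B.v by linarith
    show "\<pi> = \<pi>'"
    proof (rule permutes_eqI[OF A.\<pi> B.\<pi>])
      fix x assume "x < m + 3 * j"
      then show "\<pi> x = \<pi>' x" using A.v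
      proof (cases rule: splice_position_cases)
        case 1
        then show ?thesis using A.\<pi>_low[of x] B.\<pi>_low[of x] by simp
      next
        case (2 y)
        then show ?thesis using A.\<pi>_emb[of y] B.\<pi>_emb[of y] vv by simp
      next
        case (3 y)
        then show ?thesis using A.\<pi>_mid[of y] B.\<pi>_mid[of y] vv by simp
      next
        case (4 y)
        then show ?thesis using A.\<pi>_top[of y] B.\<pi>_top[of y] vv by simp
      qed
    qed
  qed
  then show ?thesis by (simp add: card_cartesian_product sites_count_def)
qed

lemma card_Cub_sites:
  assumes l: "1 \<le> l"
  shows "card {\<pi> \<in> Cub n. card (sites n \<pi>) = Suc l} =
     (\<Sum>j\<in>{j. 0 < j \<and> 3 * j \<le> n}. card (Av (j - 1)) * sites_count l (n - 3 * j))"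
proof -
  let ?J = "{j. 0 < j \<and> 3 * j \<le> n}"
  let ?X = "\<lambda>j. {\<pi> \<in> Cub n. \<pi> (j - 1) = n - 1 \<and> card (sites n \<pi>) = Suc l}"
  have "{\<pi> \<in> Cub n. card (sites n \<pi>) = Suc l} = (\<Union>j\<in>?J. ?X j)"
  proof (intro equalityI subsetI)
    fix \<pi> assume "\<pi> \<in> {\<pi> \<in> Cub n. card (sites n \<pi>) = Suc l}"
    then have C: "\<pi> \<in> Cub n" and c: "card (sites n \<pi>) = Suc l" by auto
    have h: "0 < n" "\<pi> (\<pi> (n - 1)) < \<pi> (n - 1)" using two_sites_iff[OF C] c l by auto
    obtain m where "n = m + 3 * Suc (\<pi> (\<pi> (n - 1)))" by (rule splice_of_Cub[OF C h])
    then have "Suc (\<pi> (\<pi> (n - 1))) \<in> ?J" by auto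
    moreover have "\<pi> \<in> ?X (Suc (\<pi> (\<pi> (n - 1))))" using C c CubD(4)[OF C] by auto
    ultimately show "\<pi> \<in> (\<Union>j\<in>?J. ?X j)" by blast
  qed auto
  moreover have "card (\<Union>j\<in>?J. ?X j) = (\<Sum>j\<in>?J. card (?X j))"
  proof (rule card_UN_disjoint)
    show "finite ?J" by (rule finite_subset[of _ "{..n}"]) auto
    show "\<forall>i\<in>?J. \<forall>j\<in>?J. i \<noteq> j \<longrightarrow> ?X i \<inter> ?X j = {}"
    proof (intro ballI impI)
      fix i j assume ij: "i \<in> ?J" "j \<in> ?J" "i \<noteq> j"
      have False if "\<pi> \<in> ?X i" "\<pi> \<in> ?X j" for \<pi>
      proof -
        have "\<pi> (i - 1) = \<pi> (j - 1)" "\<pi> \<in> Cub n" using that by auto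
        then have "i - 1 = j - 1" using Cub_eq_iff[of \<pi> n "i - 1" "j - 1"] by simp
        then show False using ij by auto
      qed
      then show "?X i \<inter> ?X j = {}" by blast
    qed
  qed auto
  moreover have "card (?X j) = card (Av (j - 1)) * sites_count l (n - 3 * j)" if "j \<in> ?J" for j
    using card_Cub_max_at[OF _ l, of j n "n - 3 * j"] that by auto
  ultimately show ?thesis by simp
qed

lemma sites_count_rec:
  assumes "1 \<le> l"
  shows "sites_count (Suc l) n = sites_count (Suc (Suc l)) n +
     (\<Sum>j\<in>{j. 0 < j \<and> 3 * j \<le> n}. card (Av (j - 1)) * sites_count l (n - 3 * j))"
proof -
  have "{\<pi> \<in> Cub n. Suc l \<le> card (sites n \<pi>)} =
      {\<pi> \<in> Cub n. Suc (Suc l) \<le> card (sites n \<pi>)} \<union> {\<pi> \<in> Cub n. card (sites n \<pi>) = Suc l}" by auto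
  then show ?thesis using card_Cub_sites[OF assms, of n] unfolding sites_count_def
    by (simp add: card_Un_disjoint disjoint_iff)
qed

lemma Cub_fixing_last: "{\<pi> \<in> Cub (Suc N). \<pi> N = N} = Cub N"
proof (intro equalityI subsetI)
  fix \<pi> assume "\<pi> \<in> {\<pi> \<in> Cub (Suc N). \<pi> N = N}"
  then have C: "\<pi> \<in> Cub (Suc N)" and f: "\<pi> N = N" by auto
  have "\<pi> permutes {..<N}"
    by (rule permutes_superset[OF CubD(2)[OF C]]) (use f in auto)
  moreover have "avoids132 N \<pi>" using CubD(3)[OF C] by (auto simp: avoids132_def)
  ultimately show "\<pi> \<in> Cub N" using CubD(4)[OF C] by (auto simp: Cub_def Av_def)
next
  fix \<pi> assume C: "\<pi> \<in> Cub N"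
  have "\<pi> N = N" using CubD(2)[OF C] by (simp add: permutes_not_in)
  moreover have "\<pi> permutes {..<Suc N}" "avoids132 (Suc N) \<pi>"
    using Av_pred_permutes[of \<pi> "Suc N"] Av_pred_avoids[of \<pi> "Suc N"] CubD(1)[OF C] by auto
  ultimately show "\<pi> \<in> {\<pi> \<in> Cub (Suc N). \<pi> N = N}" using CubD(4)[OF C] by (auto simp: Cub_def Av_def)
qed

text \<open>The last point is fixed or its cycle has one of two orientations, which squaring, that
  is inversion, exchanges; \<open>two_sites_iff\<close> counts one of them.\<close>

lemma card_Cub_Suc: "card (Cub (Suc N)) = card (Cub N) + 2 * sites_count 2 (Suc N)"
proof -
  let ?P = "{\<pi> \<in> Cub (Suc N). \<pi> (\<pi> N) < \<pi> N}" and ?Q = "{\<pi> \<in> Cub (Suc N). \<pi> N < \<pi> (\<pi> N)}"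
  have "\<pi> N = N \<or> \<pi> (\<pi> N) < \<pi> N \<or> \<pi> N < \<pi> (\<pi> N)" if "\<pi> \<in> Cub (Suc N)" for \<pi>
    using Cub_eq_iff[OF that, of N "\<pi> N"] by linarith
  then have "Cub (Suc N) = {\<pi> \<in> Cub (Suc N). \<pi> N = N} \<union> (?P \<union> ?Q)" by blast
  moreover have "card \<dots> = card {\<pi> \<in> Cub (Suc N). \<pi> N = N} + (card ?P + card ?Q)"
  proof -
    have "{\<pi> \<in> Cub (Suc N). \<pi> N = N} \<inter> (?P \<union> ?Q) = {}"
    proof -
      have False if "\<pi> \<in> Cub (Suc N)" "\<pi> N = N" "\<pi> (\<pi> N) < \<pi> N \<or> \<pi> N < \<pi> (\<pi> N)" for \<pi>
        using that by simp
      then show ?thesis by blast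
    qed
    moreover have "?P \<inter> ?Q = {}" by (simp add: disjoint_iff)
    ultimately show ?thesis by (simp add: card_Un_disjoint)
  qed
  moreover have "card ?Q = card ?P"
  proof (rule card_bij_eq[of "\<lambda>p. p \<circ> p" _ _ "\<lambda>p. p \<circ> p"])
    have inv: "(\<pi> \<circ> \<pi>) \<circ> (\<pi> \<circ> \<pi>) = \<pi>" if "\<pi> \<in> Cub (Suc N)" for \<pi>
      using CubD(4)[OF that] by (simp add: fun_eq_iff)
    then have "inj_on (\<lambda>p. p \<circ> p) (Cub (Suc N))"
      by (intro inj_on_inverseI[of _ "\<lambda>p. p \<circ> p"])
    then show "inj_on (\<lambda>p. p \<circ> p) ?Q" "inj_on (\<lambda>p. p \<circ> p) ?P"
      by (auto elim: inj_on_subset)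
    have "\<pi> \<circ> \<pi> \<in> ?P" if "\<pi> \<in> ?Q" for \<pi> using that Cub_square[of \<pi>] CubD(4)[of \<pi> "Suc N"] by simp
    then show "(\<lambda>p. p \<circ> p) ` ?Q \<subseteq> ?P" by blast
    have "\<pi> \<circ> \<pi> \<in> ?Q" if "\<pi> \<in> ?P" for \<pi> using that Cub_square[of \<pi>] CubD(4)[of \<pi> "Suc N"] by simp
    then show "(\<lambda>p. p \<circ> p) ` ?P \<subseteq> ?Q" by blast
  qed auto
  moreover have "sites_count 2 (Suc N) = card ?P"
  proof -
    have "{\<pi> \<in> Cub (Suc N). 2 \<le> card (sites (Suc N) \<pi>)} = ?P"
      by (rule Collect_cong, rule conj_cong[OF refl], subst two_sites_iff) simp_all
    then show ?thesis by (simp add: sites_count_def)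
  qed
  ultimately show ?thesis using Cub_fixing_last[of N] by simp
qed

lemma card_Cub_0: "card (Cub 0) = 1"
proof -
  have "Cub 0 = {id}" by (auto simp: Cub_def Av_def avoids132_def permutes_empty)
  then show ?thesis by simp
qed

section \<open>Generating functions\<close>

text \<open>The errors \<open>d l = t (Suc l) - g * t l\<close> satisfy \<open>d (Suc l) = (1 - g) * d l\<close> with \<open>1 - g\<close> a unit, while
  the order of \<open>d l\<close> grows with \<open>l\<close>; hence they all vanish.\<close>

lemma fps_kernel_solution:
  fixes t :: "nat \<Rightarrow> 'a :: field fps"
  assumes rec: "\<And>l. 1 \<le> l \<Longrightarrow> t (Suc l) = t (Suc (Suc l)) + q * t l"
    and small: "\<And>l n. Suc n < l \<Longrightarrow> fps_nth (t l) n = 0"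
    and g: "g = q + g ^ 2" "fps_nth g 0 = 0"
  shows "t 2 = g * t 1"
proof (rule ccontr)
  define d where "d = (\<lambda>l. t (Suc l) - g * t l)"
  assume "t 2 \<noteq> g * t 1"
  then have d1: "d 1 \<noteq> 0" by (simp add: d_def numeral_2_eq_2)
  have q: "q = g - g ^ 2" using g(1) by (simp add: algebra_simps)
  have step: "d (Suc l) = (1 - g) * d l" if "1 \<le> l" for l
  proof -
    have "t (Suc (Suc l)) = t (Suc l) - (g - g ^ 2) * t l" using rec[OF that] q by simp
    then show ?thesis by (simp add: d_def algebra_simps power2_eq_square)
  qed
  have d: "d (Suc l) = (1 - g) ^ l * d 1" for l
    by (induction l) (simp_all add: step mult.assoc)
  have "fps_nth (d (Suc l)) n = 0" if "n < l" for l n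
    using small that by (auto simp: d_def fps_mult_nth intro!: sum.neutral)
  moreover have "fps_nth (d (Suc l)) (subdegree (d 1)) \<noteq> 0" for l
  proof -
    have ne: "fps_nth ((1 - g) ^ l) 0 \<noteq> 0" using g(2) by (simp add: fps_power_zeroth)
    have "subdegree ((1 - g) ^ l) = 0" using ne by (rule subdegree_eq_0)
    moreover have nz: "(1 - g) ^ l \<noteq> 0" using ne by force
    ultimately have "subdegree (d (Suc l)) = subdegree (d 1)"
      unfolding d[of l] by (subst subdegree_mult[OF nz d1]) simp
    moreover have "d (Suc l) \<noteq> 0" unfolding d[of l] using nz d1 by (rule no_zero_divisors)
    ultimately show ?thesis using nth_subdegree_nonzero[of "d (Suc l)"] by simp
  qed
  ultimately show False by blast
qed

text \<open>Two square roots differ by a sign, which the constant term decides.\<close>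

lemma fps_square_root_unique:
  fixes F G :: "complex fps"
  assumes "F ^ 2 = G ^ 2" "fps_nth F 0 = 1" "fps_nth G 0 = 1"
  shows "F = G"
proof -
  have "(F - G) * (F + G) = 0" using assms(1) by (simp add: power2_eq_square algebra_simps)
  moreover have "fps_nth (F + G) 0 \<noteq> 0" using assms(2,3) by simp
  then have "F + G \<noteq> 0" by (metis fps_zero_nth)
  ultimately show ?thesis by simp
qed

definition Av_fps :: "complex fps" where
  "Av_fps = Abs_fps (\<lambda>n. of_nat (card (Av n)))"

text \<open>The weight of one splice: blocks of length \<open>j\<close> add \<open>3 * j\<close>
  points and leave a choice of \<open>\<tau>\<close> in \<open>Av (j - 1)\<close>.\<close>

definition block_fps :: "complex fps" where
  "block_fps = fps_X ^ 3 * (Av_fps oo fps_X ^ 3)"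

definition sites_fps :: "nat \<Rightarrow> complex fps" where
  "sites_fps l = Abs_fps (\<lambda>n. of_nat (sites_count l n))"

lemma Av_fps_eq: "Av_fps = 1 + fps_X * Av_fps ^ 2"
proof (rule fps_ext)
  have "fps_nth (Av_fps ^ 2) n = of_nat (card (Av (Suc n)))" for n
    by (simp add: power2_eq_square fps_mult_nth Av_fps_def card_Av_Suc atLeast0AtMost)
  then show "fps_nth Av_fps n = fps_nth (1 + fps_X * Av_fps ^ 2) n" for n
    by (cases n) (simp_all add: card_Av_0, simp_all add: Av_fps_def card_Av_0)
qed

lemma block_fps_eq: "block_fps = fps_X ^ 3 + block_fps ^ 2"
proof -
  have "Av_fps oo fps_X ^ 3 = (1 + fps_X * Av_fps ^ 2) oo fps_X ^ 3" using Av_fps_eq by simp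
  also have "\<dots> = 1 + fps_X ^ 3 * (Av_fps oo fps_X ^ 3) ^ 2"
    by (simp add: fps_compose_add_distrib fps_compose_mult_distrib fps_compose_power)
  finally have D: "Av_fps oo fps_X ^ 3 = 1 + fps_X ^ 3 * (Av_fps oo fps_X ^ 3) ^ 2" .
  have "Y * D = Y + (Y * D) ^ 2" if "D = 1 + Y * D ^ 2" for D Y :: "complex fps"
  proof -
    have "Y * D = Y * (1 + Y * D ^ 2)" using that by (rule arg_cong)
    also have "\<dots> = Y + (Y * D) ^ 2" by (simp add: algebra_simps power2_eq_square)
    finally show ?thesis .
  qed
  from this[OF D] show ?thesis unfolding block_fps_def .
qed

lemma block_fps_nth_mult3: "0 < j \<Longrightarrow> fps_nth block_fps (3 * j) = of_nat (card (Av (j - 1)))"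
  by (cases j) (simp_all add: block_fps_def fps_X_power_mult_nth fps_nth_compose_X_power Av_fps_def)

lemma block_fps_nth_eq_0: "\<nexists>j. 0 < j \<and> i = 3 * j \<Longrightarrow> fps_nth block_fps i = 0"
proof -
  assume h: "\<nexists>j. 0 < j \<and> i = 3 * j"
  have "i < 3 \<or> \<not> 3 dvd i - 3"
  proof (rule ccontr)
    assume "\<not> ?thesis"
    then have "3 \<le> i" "3 dvd i - 3" by auto
    then obtain k where "i - 3 = 3 * k" by (auto elim: dvdE)
    then have "i = 3 * Suc k" using \<open>3 \<le> i\<close> by auto
    then show False using h by blast
  qed
  then show ?thesis
    by (auto simp: block_fps_def fps_X_power_mult_nth fps_nth_compose_X_power)
qed

lemma sites_fps_rec:
  assumes "1 \<le> l"
  shows "sites_fps (Suc l) = sites_fps (Suc (Suc l)) + block_fps * sites_fps l"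
proof (rule fps_ext)
  fix n :: nat
  let ?J = "{j. 0 < j \<and> 3 * j \<le> n}"
  have "fps_nth (block_fps * sites_fps l) n = (\<Sum>i\<in>(\<lambda>j. 3 * j) ` ?J. fps_nth block_fps i * of_nat (sites_count l (n - i)))"
    unfolding fps_mult_nth sites_fps_def fps_nth_Abs_fps
  proof (rule sum.mono_neutral_right)
    show "\<forall>i\<in>{0..n} - (\<lambda>j. 3 * j) ` ?J. fps_nth block_fps i * of_nat (sites_count l (n - i)) = 0"
      using block_fps_nth_eq_0 by fastforce
  qed auto
  also have "\<dots> = (\<Sum>j\<in>?J. fps_nth block_fps (3 * j) * of_nat (sites_count l (n - 3 * j)))"
    by (subst sum.reindex) (auto simp: inj_on_def)
  also have "\<dots> = of_nat (\<Sum>j\<in>?J. card (Av (j - 1)) * sites_count l (n - 3 * j))"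
    by (simp add: block_fps_nth_mult3)
  finally show "fps_nth (sites_fps (Suc l)) n = fps_nth (sites_fps (Suc (Suc l)) + block_fps * sites_fps l) n"
    using sites_count_rec[OF assms, of n] by (simp add: sites_fps_def)
qed

lemma sites_fps_1: "sites_fps 1 = 1 + fps_X * sites_fps 1 + 2 * sites_fps 2"
proof (rule fps_ext)
  fix n show "fps_nth (sites_fps 1) n = fps_nth (1 + fps_X * sites_fps 1 + 2 * sites_fps 2) n"
    by (cases n) (simp_all add: sites_fps_def sites_count_one[unfolded One_nat_def] card_Cub_0 sites_count_eq_0 card_Cub_Suc)
qed

lemma csqrt_analytic_at_one [analytic_intros]:
  assumes "f analytic_on {0}" "f 0 = 1"
  shows "(\<lambda>z. csqrt (f z)) analytic_on {0}"
proof -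
  have "csqrt \<circ> f analytic_on {0}"
    by (rule analytic_on_compose) (use assms in \<open>auto intro!: analytic_intros simp: complex_nonpos_Reals_iff\<close>)
  then show ?thesis by (simp add: o_def)
qed

text \<open>Analyticity of the closed form at 0 supplies the convergence that a formal series lacks.
  Square roots are identified by their squares and their constant term 1.\<close>

lemma sites_fps_1_expansion:
  "(\<lambda>z. inverse (csqrt (2 * csqrt (1 - 4 * z ^ 3) - 1) - z)) has_fps_expansion sites_fps 1"
proof -
  define s1 where "s1 = (\<lambda>z. csqrt (1 - 4 * z ^ 3))"
  define s2 where "s2 = (\<lambda>z. csqrt (2 * s1 z - 1))"
  have s1_an: "s1 analytic_on {0}" unfolding s1_def by (intro analytic_intros) auto
  have s2_an: "s2 analytic_on {0}" unfolding s2_def using s1_an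
    by (intro analytic_intros) (auto simp: s1_def)
  define F1 where "F1 = fps_expansion s1 0"
  define F2 where "F2 = fps_expansion s2 0"
  have F1: "s1 has_fps_expansion F1" unfolding F1_def using s1_an by (rule analytic_at_imp_has_fps_expansion_0)
  have F2: "s2 has_fps_expansion F2" unfolding F2_def using s2_an by (rule analytic_at_imp_has_fps_expansion_0)
  have F1_0: "fps_nth F1 0 = 1" using has_fps_expansion_imp_0_eq_fps_nth_0[OF F1] by (simp add: s1_def)
  have F2_0: "fps_nth F2 0 = 1" using has_fps_expansion_imp_0_eq_fps_nth_0[OF F2] by (simp add: s2_def s1_def)
  have "(\<lambda>z. s1 z * s1 z) has_fps_expansion F1 * F1" by (intro fps_expansion_intros F1)
  moreover have "(\<lambda>z. s1 z * s1 z) = (\<lambda>z. 1 - 4 * z ^ 3)"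
    by (simp add: s1_def fun_eq_iff flip: power2_eq_square)
  moreover have "(\<lambda>z::complex. 1 - 4 * z ^ 3) has_fps_expansion 1 - 4 * fps_X ^ 3"
    by (intro fps_expansion_intros)
  ultimately have F1_sq: "F1 * F1 = 1 - 4 * fps_X ^ 3" by (intro fps_expansion_unique_complex) simp_all
  have q0: "fps_nth block_fps 0 = 0" by (rule block_fps_nth_eq_0) auto
  have F1_eq: "F1 = 1 - 2 * block_fps"
  proof (rule fps_square_root_unique)
    have "block_fps - block_fps ^ 2 = fps_X ^ 3" using block_fps_eq by (simp add: algebra_simps)
    then have "F1 * F1 = 1 - 4 * (block_fps - block_fps ^ 2)" using F1_sq by simp
    then show "F1 ^ 2 = (1 - 2 * block_fps) ^ 2" by (simp add: algebra_simps power2_eq_square)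
  qed (use F1_0 q0 in simp_all)
  have "(\<lambda>z. s2 z * s2 z) has_fps_expansion F2 * F2" by (intro fps_expansion_intros F2)
  moreover have "(\<lambda>z. s2 z * s2 z) = (\<lambda>z. 2 * s1 z - 1)"
    by (simp add: s2_def fun_eq_iff flip: power2_eq_square)
  moreover have "(\<lambda>z. 2 * s1 z - 1) has_fps_expansion 2 * F1 - 1"
    by (intro fps_expansion_intros F1)
  ultimately have "F2 * F2 = 2 * F1 - 1" by (intro fps_expansion_unique_complex) simp_all
  then have F2_sq: "F2 * F2 = 1 - 4 * block_fps" using F1_eq by (simp add: algebra_simps)
  \<comment> \<open>The root of \<open>g = block_fps + g ^ 2\<close> with zero constant term, since
    \<open>F2\<close> squares to \<open>1 - 4 * block_fps\<close>.\<close>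
  define g where "g = fps_const (1 / 2) * (1 - F2)"
  have half: "fps_const (1 / 2) * 2 = (1 :: complex fps)"
    by (simp add: fps_eq_iff numeral_fps_const)
  have g2: "2 * g = 1 - F2" using arg_cong[OF half, of "\<lambda>x. x * (1 - F2)"] by (simp add: g_def ac_simps)
  have "4 * (g - g ^ 2) = 2 * (2 * g) - (2 * g) * (2 * g)" by (simp add: algebra_simps power2_eq_square)
  also have "\<dots> = 1 - F2 * F2" unfolding g2 by (simp add: algebra_simps)
  also have "\<dots> = 4 * block_fps" using F2_sq by simp
  finally have four: "4 * (g - g ^ 2) = 4 * block_fps" .
  have "g - g ^ 2 = block_fps"
  proof (rule fps_ext)
    fix n show "fps_nth (g - g ^ 2) n = fps_nth block_fps n"
      using arg_cong[OF four, of "\<lambda>f. fps_nth f n"] by (simp only: fps_mult_numeral_left mult_cancel_left) simp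
  qed
  then have g: "g = block_fps + g ^ 2" by (simp add: algebra_simps)
  have "sites_fps 2 = g * sites_fps 1"
    by (rule fps_kernel_solution[of sites_fps block_fps g, OF sites_fps_rec _ g]) (auto simp: sites_fps_def sites_count_eq_0 g_def F2_0)
  then have "sites_fps 1 = 1 + fps_X * sites_fps 1 + (2 * g) * sites_fps 1" using sites_fps_1 by (simp add: mult.assoc)
  then have "(F2 - fps_X) * sites_fps 1 = 1" unfolding g2 by (simp add: algebra_simps)
  moreover have "fps_nth (F2 - fps_X) 0 \<noteq> 0" using F2_0 by simp
  ultimately have "sites_fps 1 = inverse (F2 - fps_X)"
    by (intro fps_inverse_unique[symmetric])
  moreover have "(\<lambda>z. inverse (s2 z - z)) has_fps_expansion inverse (F2 - fps_X)"
    by (intro fps_expansion_intros F2) (use F2_0 in simp)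
  ultimately show ?thesis by (simp add: s2_def s1_def)
qed

section \<open>Real closed forms and convergence\<close>

lemma catalan_gf_eq:
  assumes "x \<le> 1 / 4" shows "catalan_gf x = 2 / (1 + sqrt (1 - 4 * x))"
proof (cases "x = 0")
  case False
  define s where "s = sqrt (1 - 4 * x)"
  have s: "0 \<le> s" "s ^ 2 = 1 - 4 * x" using assms by (auto simp: s_def)
  \<comment> \<open>Rationalising the numerator gives a form that is also valid at 0.\<close>
  then have "(1 - s) * (1 + s) = 4 * x" by (simp add: algebra_simps power2_eq_square)
  then have "(1 - s) / (2 * x) = 2 / (1 + s)" using False s by (simp add: field_simps)
  then show ?thesis using False by (simp add: catalan_gf_def s_def)
qed (simp add: catalan_gf_def)

text \<open>All rests on \<open>c = 2 / (1 + s)\<close>, which makes \<open>c * (4 - 3 * c)\<close>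
  the square of \<open>c * w\<close>. The bound on \<open>z\<close> keeps the radicands and
  \<open>w - z\<close> positive.\<close>

lemma closed_forms:
  fixes z :: real
  assumes z: "\<bar>z\<bar> < 1 / 4"
  defines "s \<equiv> sqrt (1 - 4 * z ^ 3)"
  defines "w \<equiv> sqrt (2 * s - 1)" and "c \<equiv> catalan_gf (z ^ 3)"
  shows "15 / 16 \<le> s"
    and "c / (sqrt (c * (4 - 3 * c)) - z * c) = 1 / (w - z)"
    and "1 / (1 - z) * F_tx (2 / (1 - z)) (c - 1) = 1 / (w - z)"
proof -
  have "\<bar>z\<bar> ^ 3 \<le> (1 / 4) ^ 3" using z by (intro power_mono) auto
  moreover have "(1 / 4 :: real) ^ 3 = 1 / 64" by (simp add: power3_eq_cube)
  ultimately have z3: "\<bar>z ^ 3\<bar> \<le> 1 / 64" by (simp add: power_abs)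
  then show s: "15 / 16 \<le> s" unfolding s_def by (intro real_le_rsqrt) (auto simp: power2_eq_square)
  have w: "1 / 2 \<le> w" unfolding w_def using s by (intro real_le_rsqrt) (auto simp: power2_eq_square)
  have w2: "w ^ 2 = 2 * s - 1" unfolding w_def using s by simp
  have c: "c = 2 / (1 + s)" unfolding c_def s_def using z3 by (intro catalan_gf_eq) auto
  have c0: "0 < c" using s c by simp
  have "c * (4 - 3 * c) = c ^ 2 * (4 / c - 3)" using c0 by (simp add: field_simps power2_eq_square)
  also have "4 / c - 3 = w ^ 2" unfolding c w2 using s by (simp add: field_simps)
  finally have cw: "c * (4 - 3 * c) = (c * w) ^ 2" by (simp add: power_mult_distrib)
  then have sq: "sqrt (c * (4 - 3 * c)) = c * w" using c0 w by simp
  show "c / (sqrt (c * (4 - 3 * c)) - z * c) = 1 / (w - z)"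
  proof -
    have "c * w - z * c = c * (w - z)" by (simp add: algebra_simps)
    then show ?thesis unfolding sq using c0 by simp
  qed
  \<comment> \<open>The radicand of \<open>motzkin_m\<close> at \<open>c - 1\<close> is the same
    square.\<close>
  have "1 - 2 * (c - 1) - 3 * (c - 1) ^ 2 = c * (4 - 3 * c)" by (simp add: algebra_simps power2_eq_square)
  then have m: "motzkin_m (2 / (1 - z)) (c - 1) = 2 / (1 - 2 * (2 / (1 - z)) * (c - 1) + (c - 1) + c * w)"
    unfolding motzkin_m_def using sq by simp
  have z1: "1 - z > 0" "w - z > 0" using z w by auto
  define D where "D = c * (1 + w) * (w - z)"
  have D: "D > 0" unfolding D_def using c0 w z1 by simp
  have cD: "(1 - z) * (c + c * w) - 4 * (c - 1) = D"
  proof -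
    \<comment> \<open>The factor \<open>c\<close> produces the square of \<open>c * w\<close>, which
      \<open>cw\<close> rewrites.\<close>
    have "c * ((1 - z) * (c + c * w) - 4 * (c - 1)) = c * D" unfolding D_def using cw
      by (simp add: algebra_simps power2_eq_square)
    then show ?thesis using c0 by simp
  qed
  have "1 - 2 * (2 / (1 - z)) * (c - 1) + (c - 1) + c * w = ((1 - z) * (c + c * w) - 4 * (c - 1)) / (1 - z)"
    using z1 by (simp add: field_simps)
  then have m': "motzkin_m (2 / (1 - z)) (c - 1) = 2 * (1 - z) / D" unfolding m cD by simp
  have "1 / (1 - z) * F_tx (2 / (1 - z)) (c - 1) = 1 / (1 - z) * ((D + 4 * (c - 1)) / D)"
  proof -
    have "x * (2 / a) * (2 * a / D) = 4 * x / D" if "a \<noteq> 0" for x a :: real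
      using that D by (simp add: field_simps)
    from this[of "1 - z" "c - 1"] have "F_tx (2 / (1 - z)) (c - 1) = 1 + 4 * (c - 1) / D"
      unfolding F_tx_def m' using z1 by (simp only:)
    also have "\<dots> = (D + 4 * (c - 1)) / D" using D by (simp add: add_divide_distrib)
    finally show ?thesis by simp
  qed
  also have "D + 4 * (c - 1) = (1 - z) * (c * (1 + w))" using cD by (simp add: algebra_simps)
  also have "1 / (1 - z) * ((1 - z) * (c * (1 + w)) / D) = 1 / (w - z)"
  proof -
    have "1 / a * (a * b / (b * d)) = 1 / d" if "a \<noteq> 0" "b \<noteq> 0" for a b d :: real
      using that by simp
    from this[of "1 - z" "c * (1 + w)" "w - z"] show ?thesis unfolding D_def using z1 c0 w by simp
  qed
  finally show "1 / (1 - z) * F_tx (2 / (1 - z)) (c - 1) = 1 / (w - z)" .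
qed

theorem theorem4p9:
  shows "\<exists>r>0. \<forall>z::real. \<bar>z\<bar> < r \<longrightarrow>
     (\<lambda>n. real (A13_132 n) * z ^ n) sums
        (1 / (1 - z) * F_tx (2 / (1 - z)) (catalan_gf (z ^ 3) - 1)) \<and>
     (\<lambda>n. real (A13_132 n) * z ^ n) sums
        (catalan_gf (z ^ 3) /
           (sqrt (catalan_gf (z ^ 3) * (4 - 3 * catalan_gf (z ^ 3))) - z * catalan_gf (z ^ 3)))"
proof -
  define h where "h = (\<lambda>z. inverse (csqrt (2 * csqrt (1 - 4 * z ^ 3) - 1) - z))"
  have "h has_fps_expansion sites_fps 1" unfolding h_def by (rule sites_fps_1_expansion)
  then have R: "fps_conv_radius (sites_fps 1) > 0" and ev: "eventually (\<lambda>z. eval_fps (sites_fps 1) z = h z) (nhds 0)"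
    by (auto simp: has_fps_expansion_def)
  obtain e where e: "e > 0" "\<And>z. norm z < e \<Longrightarrow> eval_fps (sites_fps 1) z = h z"
    using ev unfolding eventually_nhds_metric by (auto simp: dist_norm)
  obtain d where d': "0 < ereal d" and d: "ereal d < fps_conv_radius (sites_fps 1)"
    using ereal_dense2[OF R] by blast
  \<comment> \<open>\<open>1 / 4\<close> serves the real estimates, \<open>e\<close> the agreement
    of the series with \<open>h\<close>, and \<open>d\<close> its convergence.\<close>
  define r where "r = min (1 / 4) (min e d)"
  have sums: "(\<lambda>n. real (A13_132 n) * z ^ n) sums (1 / (sqrt (2 * sqrt (1 - 4 * z ^ 3) - 1) - z))" if z: "\<bar>z\<bar> < r" for z
  proof -
    define s where "s = sqrt (1 - 4 * z ^ 3)"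
    have s: "15 / 16 \<le> s" unfolding s_def using z by (intro closed_forms(1)) (simp add: r_def)
    have "0 < s" using s by linarith
    then have "0 < 1 - 4 * z ^ 3" unfolding s_def by (simp only: real_sqrt_gt_0_iff)
    \<comment> \<open>For real \<open>z\<close> in this range both radicands are positive, so
      \<open>csqrt\<close> agrees with \<open>sqrt\<close>.\<close>
    then have "csqrt (1 - 4 * complex_of_real z ^ 3) = of_real s"
      using csqrt_of_real_nonneg[of "of_real (1 - 4 * z ^ 3)"] by (simp add: s_def)
    moreover have "csqrt (2 * of_real s - 1) = of_real (sqrt (2 * s - 1))"
      using csqrt_of_real_nonneg[of "of_real (2 * s - 1)"] s by simp
    ultimately have h: "h (of_real z) = of_real (1 / (sqrt (2 * s - 1) - z))"
      by (simp add: h_def inverse_eq_divide)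
    have "ereal (norm (complex_of_real z)) < fps_conv_radius (sites_fps 1)"
      using z by (intro less_trans[OF _ d]) (simp add: r_def)
    then have "(\<lambda>n. fps_nth (sites_fps 1) n * of_real z ^ n) sums eval_fps (sites_fps 1) (of_real z)"
      by (rule sums_eval_fps)
    also have "eval_fps (sites_fps 1) (of_real z) = of_real (1 / (sqrt (2 * s - 1) - z))"
      using e(2)[of "of_real z"] z h by (simp add: r_def)
    finally have "(\<lambda>n. complex_of_real (real (A13_132 n) * z ^ n)) sums of_real (1 / (sqrt (2 * s - 1) - z))"
      by (simp add: sites_fps_def sites_count_one[unfolded One_nat_def] A13_132_eq)
    then show ?thesis unfolding s_def by (subst (asm) sums_of_real_iff)
  qed
  show ?thesis
  proof (intro exI[of _ r] conjI allI impI)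
    show "0 < r" using d' e(1) by (simp add: r_def)
    fix z :: real assume z: "\<bar>z\<bar> < r"
    then have z4: "\<bar>z\<bar> < 1 / 4" by (simp add: r_def)
    show "(\<lambda>n. real (A13_132 n) * z ^ n) sums
        (1 / (1 - z) * F_tx (2 / (1 - z)) (catalan_gf (z ^ 3) - 1))"
      unfolding closed_forms(3)[OF z4] by (rule sums[OF z])
    show "(\<lambda>n. real (A13_132 n) * z ^ n) sums
        (catalan_gf (z ^ 3) /
           (sqrt (catalan_gf (z ^ 3) * (4 - 3 * catalan_gf (z ^ 3))) - z * catalan_gf (z ^ 3)))"
      unfolding closed_forms(2)[OF z4] by (rule sums[OF z])
  qed
qed

end
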